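(* Let $T, k, M, B \ge 1$ be integers, let $\varepsilon_q = \varepsilon_{\mathrm{thr}}+\varepsilon_{\mathrm{RAG}}$ with $\varepsilon_{\mathrm{thr}},\varepsilon_{\mathrm{RAG}}>0$, and let $q_1,\dots,q_T \in \mathcal{V}^*$ be a sequence of queries. Consider the algorithm MuRAG-Ada (defined in the context), viewed as a randomized map that takes the private document dataset $D$ to the sequence of answers $(a_1,\dots,a_T)$. Let $\varepsilon>0$, and suppose that the initial privacy budget allocated to each document $z \in D$, namely $\mathcal{E}(z) = M\varepsilon_q$, is at most $\varepsilon$. Then MuRAG-Ada satisfies $\varepsilon$-differential privacy with respect to $D$ (under the add/remove-one-document neighboring relation).
   Context: **Privacy.** $\mathcal{V}$ is a finite vocabulary and $\mathcal{V}^*$ the set of finite token sequences. A document is an element of $\mathcal{V}^*$, and a dataset is a finite set of documents. Two datasets are neighboring (add/remove relation) if one is obtained from the other by adding or removing exactly one document. A randomized algorithm $\mathcal{M}$ is $\varepsilon$-differentially private ($\varepsilon$-DP) if $\Pr[\mathcal{M}(D)\in O]\le e^{\varepsilon}\Pr[\mathcal{M}(D')\in O]$ for all neighboring $D,D'$ and all measurable $O$. $\mathrm{Lap}(b)$ denotes a fresh independent draw from the Laplace distribution with mean $0$ and scale $b$. **Relevance, Top-K.** $r(z,q)\in\mathbb{R}$ is a fixed (data-independent) relevance score of document $z$ for query $q$. It is assumed that there are no ties. $\mathrm{TopK}(D,K,r(\cdot,q))$ returns the $K$ documents of $D$ of highest score $r(\cdot,q)$ if $|D|\ge K$. Otherwise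 it returns $D$ padded with $K-|D|$ empty strings, so that the output always has exactly $K$ entries. Padding entries are ranked below all real documents. **Language model.** $\mathrm{LLM}(x, C \mid y_{<t})\in\mathcal{V}$ is a fixed deterministic function (greedy decoding, public, independent of the private dataset). It gives the next token from a prompt $x$, a finite multiset $C$ of context documents, and the previously generated tokens $y_{<t}=(y_1,\dots,y_{t-1})$. **Single-query algorithm** $\mathrm{DPRAG}(x,D,\mathrm{LLM},\varepsilon)$. Fixed parameters: per-token budget $\varepsilon_0>0$, maximum number of tokens $T_{\max}$, number of voters $m$, documents per voter $k'$, vote threshold $\theta\in\mathbb{R}$. Put $\varepsilon_{\mathrm{Lap}}=\varepsilon_{\mathrm{Expo}}=\varepsilon_0/2$ and $c=\lfloor \varepsilon/\varepsilon_0\rfloor$ (the number of "discoveries" left). The procedure stops as soon as $c=0$. 1. Set $\hat\theta=\theta+\mathrm{Lap}(2/\varepsilon_{\mathrm{Lap}})$. 2. Let $D_x$ be the $mk'$ most relevant entries $\mathrm{TopK}(D,mk',r(\cdot,x))$. Split $D_x$ uniformly at random into $m$ chunks $D_x^{(1)},\dots,D_x^{(m)}$ of size $k'$ (the split is drawn once, independently of everything else). 3. For $t=1,\dots,T_{\max}$: - Let $b=\mathrm{LLM}(x,\emptyset\mid y_{<t})$ and $v_i=\mathrm{LLM}(x,D_x^{(i)}\mid y_{<t})$ for $i=1,\dots,m$. - For each $v\in\mathcal{V}$ let $u_v=|\{i: v_i=v\}|$, and let $s=u_b$. - If $s+\mathrm{Lap}(4/\varepsilon_{\mathrm{Lap}})\le\hat\theta$: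 draw $y_t\in\mathcal{V}$ with probability proportional to $\exp(\varepsilon_{\mathrm{Expo}}u_v/2)$ (exponential mechanism with utility sensitivity $1$), decrease $c$ by $1$, and redraw $\hat\theta=\theta+\mathrm{Lap}(2/\varepsilon_{\mathrm{Lap}})$. - Otherwise set $y_t=b$. - If $y_t$ is the end-of-sequence token or $c=0$, return $(y_1,\dots,y_t)$. 4. Return $(y_1,\dots,y_{T_{\max}})$. **Algorithm MuRAG-Ada.** Input: private dataset $D$, queries $q_1,\dots,q_T$, per-query budget $\varepsilon_q=\varepsilon_{\mathrm{thr}}+\varepsilon_{\mathrm{RAG}}$, number $k$ of retrieved documents, maximum number $M$ of retrievals per document, and a fixed data-independent discretization of the scores into $B$ pairwise disjoint bins $I_1,\dots,I_B$, $I_i=[a_i,a_{i+1})$, processed in the order $i=1,\dots,B$. Initialize $\mathcal{E}(z)=M\varepsilon_q$ for every $z\in D$. For $t=1,\dots,T$: *Step 1 (adaptive thresholding).* Set $\tilde s=0$, $A_t=\varnothing$. For $i=1,\dots,B$: - $A_t^{(i)}=\{z\in D: r(z,q_t)\in I_i,\ \mathcal{E}(z)\ge\varepsilon_{\mathrm{thr}}\}$. - $\tilde s\leftarrow\tilde s+|A_t^{(i)}|+\mathrm{Lap}(1/\varepsilon_{\mathrm{thr}})$. - $A_t\leftarrow A_t\cup A_t^{(i)}$. - For every $z\in A_t^{(i)}$, $\mathcal{E}(z)\leftarrow\mathcal{E}(z)-\varepsilon_{\mathrm{thr}}$. - If $\tilde s\ge k$, set $\tau_t=a_i$ and leave the loop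 over $i$. *Step 2 (answer).* - $A_t'=\{z\in A_t:\mathcal{E}(z)\ge\varepsilon_{\mathrm{RAG}}\}$. - $D_{q_t}=\mathrm{TopK}(A_t',k,r(\cdot,q_t))$. - $a_t=\mathrm{DPRAG}(q_t,D_{q_t},\mathrm{LLM},\varepsilon_{\mathrm{RAG}})$, with fresh randomness. - For every $z\in A_t'$, $\mathcal{E}(z)\leftarrow\mathcal{E}(z)-\varepsilon_{\mathrm{RAG}}$. Output $(a_1,\dots,a_T)$. *)

theory Defs
  imports "HOL-Probability.Probability"
begin

text \<open>A token vocabulary is a type of class \<open>finite\<close>. An entry of a retrieved list is either a
  real document \<open>Some z\<close> or a padding entry \<open>None\<close>. Padding is kept distinct from a real document
  that happens to be the empty string, because padding is ranked below all real documents; it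
  becomes the empty string when it is handed to the language model.\<close>

type_synonym 'v doc = "'v list"
type_synonym 'v entry = "'v doc option"
type_synonym 'v score = "'v doc \<Rightarrow> 'v list \<Rightarrow> real"
type_synonym 'v llm = "'v list \<Rightarrow> 'v doc multiset \<Rightarrow> 'v list \<Rightarrow> 'v"

section \<open>Differential privacy\<close>

definition neighboring :: "'a set \<Rightarrow> 'a set \<Rightarrow> bool" where
  "neighboring D D' \<longleftrightarrow> (\<exists>z. z \<notin> D \<and> D' = insert z D) \<or> (\<exists>z. z \<notin> D' \<and> D = insert z D')"

text \<open>\<open>\<D>\<close> is the collection of admissible datasets and \<open>N\<close> the output space. The first conjunct says
  that \<open>A\<close> is a randomized algorithm, i.e. each \<open>A D\<close> is a probability distribution on \<open>N\<close>; it
  also excludes junk values of \<open>bind\<close> on non-measurable kernels.\<close>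

definition differentially_private ::
    "'a set set \<Rightarrow> 'b measure \<Rightarrow> real \<Rightarrow> ('a set \<Rightarrow> 'b measure) \<Rightarrow> bool" where
  "differentially_private \<D> N \<epsilon> A \<longleftrightarrow>
     (\<forall>D\<in>\<D>. A D \<in> space (prob_algebra N)) \<and>
     (\<forall>D\<in>\<D>. \<forall>D'\<in>\<D>. neighboring D D' \<longrightarrow>
        (\<forall>S\<in>sets N. measure (A D) S \<le> exp \<epsilon> * measure (A D') S))"

definition laplace :: "real \<Rightarrow> real measure" where
  "laplace b = density lborel (\<lambda>x. ennreal (exp (- \<bar>x\<bar> / b) / (2 * b)))"

text \<open>The exponential mechanism for a utility of sensitivity 1.\<close>

definition exp_mechanism :: "real \<Rightarrow> ('v::finite \<Rightarrow> nat) \<Rightarrow> 'v pmf" where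
  "exp_mechanism \<epsilon> u =
     embed_pmf (\<lambda>v. exp (\<epsilon> * real (u v) / 2) / (\<Sum>w\<in>UNIV. exp (\<epsilon> * real (u w) / 2)))"

lemma pmf_exp_mechanism:
  "pmf (exp_mechanism \<epsilon> u) v = exp (\<epsilon> * real (u v) / 2) / (\<Sum>w\<in>UNIV. exp (\<epsilon> * real (u w) / 2))"
proof -
  let ?Z = "\<Sum>w\<in>UNIV. exp (\<epsilon> * real (u w) / 2)"
  have Z: "?Z > 0" by (intro sum_pos) auto
  have "(\<integral>\<^sup>+v. ennreal (exp (\<epsilon> * real (u v) / 2) / ?Z) \<partial>count_space UNIV)
      = (\<Sum>v\<in>UNIV. ennreal (exp (\<epsilon> * real (u v) / 2) / ?Z))"
    by (rule nn_integral_count_space_finite) simp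
  also have "\<dots> = ennreal (\<Sum>v\<in>UNIV. exp (\<epsilon> * real (u v) / 2) / ?Z)"
    using Z by (intro sum_ennreal) (simp add: less_imp_le)
  also have "(\<Sum>v\<in>UNIV. exp (\<epsilon> * real (u v) / 2) / ?Z) = 1"
    using Z by (simp flip: sum_divide_distrib)
  finally show ?thesis
    unfolding exp_mechanism_def using Z by (intro pmf_embed_pmf) (auto simp: less_imp_le)
qed

section \<open>Retrieval\<close>

fun rank :: "('v doc \<Rightarrow> real) \<Rightarrow> 'v entry \<Rightarrow> ereal" where
  "rank f None = -\<infinity>"
| "rank f (Some z) = ereal (f z)"

text \<open>The chosen list orders the entries of \<open>X\<close> by decreasing rank; it is unique if \<open>f\<close> has no ties
  on the real documents in \<open>X\<close> and these have multiplicity one.\<close>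

definition topk :: "'v entry multiset \<Rightarrow> nat \<Rightarrow> ('v doc \<Rightarrow> real) \<Rightarrow> 'v entry list" where
  "topk X K f =
     take K ((SOME xs. mset xs = X \<and> sorted_wrt (\<lambda>e e'. rank f e \<ge> rank f e') xs) @ replicate K None)"

lemma length_topk: "length (topk X K f) = K"
  by (simp add: topk_def)

text \<open>A split of \<open>m * l\<close> positions into \<open>m\<close> chunks of size \<open>l\<close> assigns to each position the
  index of its chunk.\<close>

definition splits :: "nat \<Rightarrow> nat \<Rightarrow> (nat \<Rightarrow> nat) set" where
  "splits m l = {\<sigma> \<in> {..<m * l} \<rightarrow>\<^sub>E {..<m}. \<forall>i<m. card {j. j < m * l \<and> \<sigma> j = i} = l}"

definition chunk :: "'v entry list \<Rightarrow> (nat \<Rightarrow> nat) \<Rightarrow> nat \<Rightarrow> 'v doc multiset" where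
  "chunk X \<sigma> i =
     {# (case X ! j of None \<Rightarrow> [] | Some z \<Rightarrow> z). j \<in># mset_set {j. j < length X \<and> \<sigma> j = i} #}"

lemma finite_splits: "finite (splits m l)"
  unfolding splits_def by (rule finite_subset[of _ "{..<m * l} \<rightarrow>\<^sub>E {..<m}"]) (auto intro: finite_PiE)

lemma splits_nonempty: "splits m l \<noteq> {}"
proof -
  let ?\<sigma> = "\<lambda>j. if j < m * l then j div l else undefined"
  have "card {j. j < m * l \<and> ?\<sigma> j = i} = l" if "i < m" for i
  proof (cases "l = 0")
    case False
    have le: "Suc i * l \<le> m * l"
      using that by (intro mult_le_mono1) simp
    have eq: "j < m * l \<and> ?\<sigma> j = i \<longleftrightarrow> i * l \<le> j \<and> j < Suc i * l" for j
    proof -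
      have "j < m * l \<and> ?\<sigma> j = i \<longleftrightarrow> j < m * l \<and> i \<le> j div l \<and> j div l < Suc i"
        by (cases "j < m * l") (simp_all only: if_True less_Suc_eq_le eq_iff conj_commute simp_thms)
      also have "\<dots> \<longleftrightarrow> j < m * l \<and> i * l \<le> j \<and> j < Suc i * l"
        using False by (simp only: less_eq_div_iff_mult_less_eq div_less_iff_less_mult neq0_conv)
      also have "\<dots> \<longleftrightarrow> i * l \<le> j \<and> j < Suc i * l"
        using le by (blast intro: order_less_le_trans)
      finally show ?thesis .
    qed
    have "{j. j < m * l \<and> ?\<sigma> j = i} = {i * l..<Suc i * l}"
      unfolding eq by (rule set_eqI) (simp only: mem_Collect_eq atLeastLessThan_iff)
    then show ?thesis by simp
  qed simp
  then have "?\<sigma> \<in> splits m l"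
    unfolding splits_def by (auto simp: less_mult_imp_div_less PiE_def extensional_def)
  then show ?thesis by blast
qed

section \<open>The single-query algorithm\<close>

record 'v dprag_params =
  token_budget :: real
  max_tokens :: nat
  voters :: nat
  docs_per_voter :: nat
  vote_threshold :: real
  eos :: 'v

definition votes :: "'v llm \<Rightarrow> 'v list \<Rightarrow> nat \<Rightarrow> (nat \<Rightarrow> 'v doc multiset) \<Rightarrow> 'v list \<Rightarrow> 'v \<Rightarrow> nat" where
  "votes LLM x m C ys v = card {i. i < m \<and> LLM x (C i) ys = v}"

text \<open>The arguments \<open>n\<close>, \<open>c\<close>, \<open>h\<close>, \<open>ys\<close> of the token loop are the number of iterations left, the
  number of discoveries left, the current noisy threshold, and the tokens generated so far. Both
  halves of the per-token budget are \<open>token_budget P / 2\<close>.\<close>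

primrec dprag_loop ::
    "'v::finite dprag_params \<Rightarrow> 'v llm \<Rightarrow> 'v list \<Rightarrow> (nat \<Rightarrow> 'v doc multiset) \<Rightarrow>
     nat \<Rightarrow> nat \<Rightarrow> real \<Rightarrow> 'v list \<Rightarrow> 'v list measure" where
  "dprag_loop P LLM x C 0 c h ys = return (count_space UNIV) ys"
| "dprag_loop P LLM x C (Suc n) c h ys =
     (let \<epsilon>_Lap = token_budget P / 2;
          \<epsilon>_Expo = token_budget P / 2;
          b = LLM x {#} ys;
          u = votes LLM x (voters P) C ys;
          continue = (\<lambda>c' h' ys'. if last ys' = eos P \<or> c' = 0 then return (count_space UNIV) ys'
                                  else dprag_loop P LLM x C n c' h' ys')
      in do {
        \<xi> \<leftarrow> laplace (4 / \<epsilon>_Lap);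
        if real (u b) + \<xi> \<le> h then do {
          y \<leftarrow> measure_pmf (exp_mechanism \<epsilon>_Expo u);
          \<eta> \<leftarrow> laplace (2 / \<epsilon>_Lap);
          continue (c - 1) (vote_threshold P + \<eta>) (ys @ [y])
        } else continue c h (ys @ [b])
      })"

definition dprag ::
    "'v::finite dprag_params \<Rightarrow> 'v score \<Rightarrow> 'v list \<Rightarrow> 'v entry multiset \<Rightarrow> 'v llm \<Rightarrow> real \<Rightarrow>
     'v list measure" where
  "dprag P r x X LLM \<epsilon> =
     (let \<epsilon>_Lap = token_budget P / 2;
          m = voters P;
          l = docs_per_voter P;
          c = nat \<lfloor>\<epsilon> / token_budget P\<rfloor>
      in if c = 0 then return (count_space UNIV) []
         else do {
           \<eta> \<leftarrow> laplace (2 / \<epsilon>_Lap);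
           \<sigma> \<leftarrow> measure_pmf (pmf_of_set (splits m l));
           dprag_loop P LLM x (chunk (topk X (m * l) (\<lambda>z. r z x)) \<sigma>)
             (max_tokens P) c (vote_threshold P + \<eta>) []
         })"

section \<open>MuRAG-Ada\<close>

text \<open>Subtract \<open>\<delta>\<close> from the budget of every document in \<open>S\<close>.\<close>

definition charge :: "real \<Rightarrow> 'a set \<Rightarrow> ('a \<Rightarrow> real) \<Rightarrow> 'a \<Rightarrow> real" where
  "charge \<delta> S E z = (if z \<in> S then E z - \<delta> else E z)"

text \<open>The thresholding loop over the remaining bin indices; bin \<open>i\<close> is \<open>{a i..<a (Suc i)}\<close>. It returns
  the updated budgets and the set of selected documents. The threshold \<open>a i\<close> at which the loop is
  left is never read by the algorithm and is not part of its output, so it is not recorded.\<close>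

primrec threshold_loop ::
    "(nat \<Rightarrow> real) \<Rightarrow> ('v doc \<Rightarrow> real) \<Rightarrow> real \<Rightarrow> nat \<Rightarrow> 'v doc set \<Rightarrow>
     nat list \<Rightarrow> ('v doc \<Rightarrow> real) \<Rightarrow> real \<Rightarrow> 'v doc set \<Rightarrow> (('v doc \<Rightarrow> real) \<times> 'v doc set) measure" where
  "threshold_loop a f \<epsilon>_thr k D [] E s A = return (count_space UNIV) (E, A)"
| "threshold_loop a f \<epsilon>_thr k D (i # is) E s A =
     (let A_i = {z \<in> D. f z \<in> {a i..<a (Suc i)} \<and> E z \<ge> \<epsilon>_thr};
          A' = A \<union> A_i;
          E' = charge \<epsilon>_thr A_i E
      in do {
        \<xi> \<leftarrow> laplace (1 / \<epsilon>_thr);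
        let s' = s + real (card A_i) + \<xi>;
        if s' \<ge> real k then return (count_space UNIV) (E', A')
        else threshold_loop a f \<epsilon>_thr k D is E' s' A'
      })"

primrec murag_ada_loop ::
    "'v::finite dprag_params \<Rightarrow> 'v score \<Rightarrow> 'v llm \<Rightarrow> nat \<Rightarrow> (nat \<Rightarrow> real) \<Rightarrow> real \<Rightarrow> real \<Rightarrow> nat \<Rightarrow>
     'v doc set \<Rightarrow> 'v list list \<Rightarrow> ('v doc \<Rightarrow> real) \<Rightarrow> 'v list list measure" where
  "murag_ada_loop P r LLM B a \<epsilon>_thr \<epsilon>_RAG k D [] E = return (count_space UNIV) []"
| "murag_ada_loop P r LLM B a \<epsilon>_thr \<epsilon>_RAG k D (q # qs) E =
     do {
       (E', A) \<leftarrow> threshold_loop a (\<lambda>z. r z q) \<epsilon>_thr k D [1..<Suc B] E 0 {};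
       let A' = {z \<in> A. E' z \<ge> \<epsilon>_RAG};
       ans \<leftarrow> dprag P r q (mset (topk (mset_set (Some ` A')) k (\<lambda>z. r z q))) LLM \<epsilon>_RAG;
       rest \<leftarrow> murag_ada_loop P r LLM B a \<epsilon>_thr \<epsilon>_RAG k D qs (charge \<epsilon>_RAG A' E');
       return (count_space UNIV) (ans # rest)
     }"

definition murag_ada ::
    "'v::finite dprag_params \<Rightarrow> 'v score \<Rightarrow> 'v llm \<Rightarrow> nat \<Rightarrow> (nat \<Rightarrow> real) \<Rightarrow> real \<Rightarrow> real \<Rightarrow> nat \<Rightarrow>
     nat \<Rightarrow> 'v list list \<Rightarrow> 'v doc set \<Rightarrow> 'v list list measure" where
  "murag_ada P r LLM B a \<epsilon>_thr \<epsilon>_RAG k M qs D =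
     murag_ada_loop P r LLM B a \<epsilon>_thr \<epsilon>_RAG k D qs (\<lambda>z. real M * (\<epsilon>_thr + \<epsilon>_RAG))"

end

theory Submission
  imports Defs
begin

text \<open>Compare the runs on \<open>D\<close> and on \<open>insert z D\<close>. As long as the two runs agree on the budgets of the
  documents other than \<open>z\<close>, the distributions of their remaining outputs differ by a factor of at most
  \<open>exp e\<close>, where \<open>e\<close> is the remaining budget of \<open>z\<close> in the second run: whenever \<open>z\<close> influences a noisy
  bin count or an answer, its budget decreases by exactly the privacy cost of that step, and once the
  budget is exhausted \<open>z\<close> is ignored. A bin count costs \<open>\<epsilon>_thr\<close> because a shift of the Laplace noise by
  one compensates for \<open>z\<close>. An answer costs \<open>\<epsilon>_RAG\<close>: adding \<open>z\<close> replaces one retrieved entry, hence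
  changes the vote of a single voter after a permutation of the random split, and the token loop is a
  sparse vector algorithm with at most \<open>\<lfloor>\<epsilon>_RAG / \<epsilon>\<^sub>0\<rfloor>\<close> discoveries of cost \<open>\<epsilon>\<^sub>0\<close> each.\<close>

section \<open>Laplace noise\<close>

lemma sets_laplace [simp, measurable_cong]: "sets (laplace b) = sets borel"
  by (simp add: laplace_def)

lemma space_laplace [simp]: "space (laplace b) = UNIV"
  by (simp add: laplace_def)

lemma nn_integral_laplace:
  assumes "f \<in> borel_measurable borel"
  shows "(\<integral>\<^sup>+x. f x \<partial>laplace b) = (\<integral>\<^sup>+x. ennreal (exp (- \<bar>x\<bar> / b) / (2 * b)) * f x \<partial>lborel)"
  using assms unfolding laplace_def by (subst nn_integral_density) auto

text \<open>Off the origin the density is the average of the exponential density of rate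
  \<open>1/b\<close> and its mirror image, so its total mass is that of the exponential
  distribution.\<close>

lemma laplace_in_space_prob_algebra:
  assumes b: "b > 0"
  shows "laplace b \<in> space (prob_algebra borel)"
proof -
  have "emeasure (laplace b) (space (laplace b)) = (\<integral>\<^sup>+x. 1 \<partial>laplace b)"
    by simp
  also have "\<dots> = (\<integral>\<^sup>+x. ennreal (exp (- \<bar>x\<bar> / b) / (2 * b)) \<partial>lborel)"
    by (subst nn_integral_laplace) auto
  also have "\<dots> = (\<integral>\<^sup>+x. ennreal (1/2) * ennreal (exponential_density (1/b) x)
      + ennreal (1/2) * ennreal (exponential_density (1/b) (- x)) \<partial>lborel)"
  proof (rule nn_integral_cong_AE)
    show "AE x in lborel. ennreal (exp (- \<bar>x\<bar> / b) / (2 * b))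
        = ennreal (1/2) * ennreal (exponential_density (1/b) x)
        + ennreal (1/2) * ennreal (exponential_density (1/b) (- x))"
      \<comment> \<open>At 0 both exponential densities equal \<open>1/b\<close>, so their average
        is twice the Laplace density there; this is a null set.\<close>
      using AE_lborel_singleton[of 0]
    proof eventually_elim
      case (elim x)
      let ?u = "exponential_density (1/b) x" and ?v = "exponential_density (1/b) (- x)"
      have "exp (- \<bar>x\<bar> / b) / (2 * b) = 1/2 * ?u + 1/2 * ?v"
        using elim b by (auto simp: exponential_density_def field_simps)
      moreover have "?u \<ge> 0" "?v \<ge> 0"
        using b by (auto simp: exponential_density_def)
      ultimately show ?case
        by (simp only: ennreal_plus ennreal_mult mult_nonneg_nonneg zero_le_divide_1_iff zero_le_numeral)
    qed
  qed
  also have "\<dots> = ennreal (1/2) * (\<integral>\<^sup>+x. ennreal (exponential_density (1/b) x) \<partial>lborel)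
      + ennreal (1/2) * (\<integral>\<^sup>+x. ennreal (exponential_density (1/b) (- x)) \<partial>lborel)"
    by (subst nn_integral_add) (auto simp: nn_integral_cmult)
  also have "(\<integral>\<^sup>+x. ennreal (exponential_density (1/b) (- x)) \<partial>lborel)
      = (\<integral>\<^sup>+x. ennreal (exponential_density (1/b) x) \<partial>lborel)"
    using nn_integral_real_affine[of "\<lambda>x. ennreal (exponential_density (1/b) x)" "-1" 0] by simp
  also have "(\<integral>\<^sup>+x. ennreal (exponential_density (1/b) x) \<partial>lborel) = 1"
  proof -
    interpret prob_space "density lborel (exponential_density (1/b))"
      using b by (intro prob_space_exponential_density) auto
    show ?thesis
      using emeasure_space_1 by (simp add: emeasure_density)
  qed
  also have "ennreal (1/2) * 1 + ennreal (1/2) * 1 = ennreal (1/2 + 1/2)"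
    unfolding mult_1_right by (rule ennreal_plus[symmetric]) auto
  finally show ?thesis
    by (auto simp: space_prob_algebra intro: prob_spaceI)
qed

text \<open>By the triangle inequality the density at \<open>x - d\<close> is at most
  \<open>exp (\<bar>d\<bar> / b)\<close> times the density at \<open>x\<close>; translation
  invariance of Lebesgue measure does the rest.\<close>

lemma nn_integral_laplace_shift:
  assumes b: "b > 0" and f [measurable]: "f \<in> borel_measurable borel"
  shows "(\<integral>\<^sup>+x. f (x + d) \<partial>laplace b) \<le> ennreal (exp (\<bar>d\<bar> / b)) * (\<integral>\<^sup>+x. f x \<partial>laplace b)"
proof -
  let ?p = "\<lambda>x. exp (- \<bar>x\<bar> / b) / (2 * b)"
  have "(\<integral>\<^sup>+x. f (x + d) \<partial>laplace b) = (\<integral>\<^sup>+x. ennreal (?p x) * f (x + d) \<partial>lborel)"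
    by (rule nn_integral_laplace) measurable
  also have "\<dots> = (\<integral>\<^sup>+x. ennreal (?p (x - d)) * f x \<partial>lborel)"
    by (subst nn_integral_real_affine[where c = 1 and t = "- d"]) (auto simp: add.commute)
  also have "\<dots> \<le> (\<integral>\<^sup>+x. ennreal (exp (\<bar>d\<bar> / b)) * (ennreal (?p x) * f x) \<partial>lborel)"
  proof (rule nn_integral_mono)
    fix x
    have "- \<bar>x - d\<bar> / b \<le> \<bar>d\<bar> / b + - \<bar>x\<bar> / b"
      using b by (simp add: field_simps)
    then have "?p (x - d) \<le> exp (\<bar>d\<bar> / b) * ?p x"
      using b by (simp add: divide_right_mono flip: exp_add)
    then have "ennreal (?p (x - d)) * f x \<le> ennreal (exp (\<bar>d\<bar> / b) * ?p x) * f x"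
      by (intro mult_right_mono ennreal_leI) auto
    then show "ennreal (?p (x - d)) * f x \<le> ennreal (exp (\<bar>d\<bar> / b)) * (ennreal (?p x) * f x)"
      by (subst (asm) ennreal_mult) (use b in \<open>auto simp: mult.assoc\<close>)
  qed
  also have "\<dots> = ennreal (exp (\<bar>d\<bar> / b)) * (\<integral>\<^sup>+x. f x \<partial>laplace b)"
    by (simp add: nn_integral_cmult nn_integral_laplace)
  finally show ?thesis .
qed

section \<open>Probability kernels\<close>

text \<open>Outputs live in a discrete space, where every function is measurable, so the integral
  against a composed kernel splits for arbitrary \<open>f\<close>.\<close>

lemma nn_integral_bind_prob_algebra:
  assumes "M \<in> space (prob_algebra L)" and K: "K \<in> L \<rightarrow>\<^sub>M prob_algebra (count_space UNIV)"
  shows "(\<integral>\<^sup>+x. f x \<partial>(M \<bind> K)) = (\<integral>\<^sup>+x. \<integral>\<^sup>+y. f y \<partial>K x \<partial>M)"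
proof (rule nn_integral_bind)
  have "sets M = sets L"
    using assms(1) by (simp add: space_prob_algebra)
  then show "K \<in> M \<rightarrow>\<^sub>M subprob_algebra (count_space UNIV)"
    using measurable_prob_algebraD[OF K] by (simp cong: measurable_cong_sets)
qed simp

lemma bind_in_space_prob_algebra:
  assumes "M \<in> space (prob_algebra L)" and "K \<in> L \<rightarrow>\<^sub>M prob_algebra N"
  shows "M \<bind> K \<in> space (prob_algebra N)"
  using prob_space_bind'[OF assms] sets_bind'[OF assms] by (simp add: space_prob_algebra)

lemma return_in_space_prob_algebra:
  "x \<in> space M \<Longrightarrow> return M x \<in> space (prob_algebra M)"
  by (simp add: space_prob_algebra prob_space_return)

lemma measure_pmf_in_space_prob_algebra: "measure_pmf p \<in> space (prob_algebra (count_space UNIV))"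
  by (simp add: space_prob_algebra measure_pmf.prob_space_axioms)

lemma measurable_nn_integral_prob_algebra:
  assumes "K \<in> M \<rightarrow>\<^sub>M prob_algebra N" and "g \<in> borel_measurable N"
  shows "(\<lambda>x. \<integral>\<^sup>+y. g y \<partial>K x) \<in> borel_measurable M"
  using measurable_compose[OF measurable_prob_algebraD[OF assms(1)]
      nn_integral_measurable_subprob_algebra[OF assms(2)]] .

section \<open>Multiplicative closeness\<close>

text \<open>Privacy is tracked through integrals of arbitrary functions of the output rather than
  probabilities of events, so that the integral over the remaining run can itself serve as an
  integrand.\<close>

definition close :: "real \<Rightarrow> ennreal \<Rightarrow> ennreal \<Rightarrow> bool" where
  "close \<delta> x y \<longleftrightarrow> x \<le> ennreal (exp \<delta>) * y \<and> y \<le> ennreal (exp \<delta>) * x"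

lemma ennreal_exp_add_mult: "ennreal (exp (a + b)) * x = ennreal (exp a) * (ennreal (exp b) * x)"
  by (simp add: exp_add ennreal_mult mult.assoc)

lemma exp_le_trans:
  assumes "x \<le> ennreal (exp a) * y" and "y \<le> ennreal (exp b) * z"
  shows "x \<le> ennreal (exp (a + b)) * z"
  using assms(1) mult_left_mono[OF assms(2), of "ennreal (exp a)"]
  unfolding ennreal_exp_add_mult by (meson order_trans zero_le)

lemma close_sym: "close \<delta> x y \<Longrightarrow> close \<delta> y x"
  by (simp add: close_def)

lemma exp_le_mono:
  assumes "x \<le> ennreal (exp a) * y" and "a \<le> b"
  shows "x \<le> ennreal (exp b) * y"
  using assms(1) mult_right_mono[of "ennreal (exp a)" "ennreal (exp b)" y] assms(2)
  by (meson order_trans ennreal_leI exp_le_cancel_iff zero_le)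

lemma close_mono: "close a x y \<Longrightarrow> a \<le> b \<Longrightarrow> close b x y"
  unfolding close_def by (blast intro: exp_le_mono)

lemma close_refl: "0 \<le> \<delta> \<Longrightarrow> close \<delta> x x"
  by (rule close_mono[of 0]) (simp add: close_def)

lemma close_trans: "close a x y \<Longrightarrow> close b y z \<Longrightarrow> close (a + b) x z"
  unfolding close_def using exp_le_trans[of x a y b z] exp_le_trans[of z b y a x]
  by (simp add: add.commute)

lemma nn_integral_exp_le:
  assumes "\<And>x. x \<in> space M \<Longrightarrow> f x \<le> ennreal (exp \<delta>) * g x" and "g \<in> borel_measurable M"
  shows "(\<integral>\<^sup>+x. f x \<partial>M) \<le> ennreal (exp \<delta>) * (\<integral>\<^sup>+x. g x \<partial>M)"
  using nn_integral_mono[of M f "\<lambda>x. ennreal (exp \<delta>) * g x"] assms by (simp add: nn_integral_cmult)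

lemma close_nn_integral:
  assumes "\<And>x. x \<in> space M \<Longrightarrow> close \<delta> (f x) (g x)"
    and "f \<in> borel_measurable M" and "g \<in> borel_measurable M"
  shows "close \<delta> (\<integral>\<^sup>+x. f x \<partial>M) (\<integral>\<^sup>+x. g x \<partial>M)"
  using assms unfolding close_def by (auto intro: nn_integral_exp_le)

text \<open>A coupling: noise \<open>x\<close> of the first run is matched with \<open>x + d\<close>
  in the second, and the cost \<open>\<bar>d\<bar> / b\<close> of the shift adds to the loss
  \<open>\<delta>\<close> incurred under that matching.\<close>

lemma nn_integral_laplace_exp_le:
  assumes b: "b > 0" and le: "\<And>x. f x \<le> ennreal (exp \<delta>) * g (x + d)"
    and g [measurable]: "g \<in> borel_measurable borel"
  shows "(\<integral>\<^sup>+x. f x \<partial>laplace b) \<le> ennreal (exp (\<delta> + \<bar>d\<bar> / b)) * (\<integral>\<^sup>+x. g x \<partial>laplace b)"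
  using nn_integral_exp_le[of "laplace b" f \<delta> "\<lambda>x. g (x + d)"] le nn_integral_laplace_shift[OF b g]
  by (intro exp_le_trans) auto

lemma close_nn_integral_laplace:
  assumes b: "b > 0" and close: "\<And>x. close \<delta> (f x) (g (x + d))"
    and [measurable]: "f \<in> borel_measurable borel" "g \<in> borel_measurable borel"
  shows "close (\<delta> + \<bar>d\<bar> / b) (\<integral>\<^sup>+x. f x \<partial>laplace b) (\<integral>\<^sup>+x. g x \<partial>laplace b)"
proof -
  \<comment> \<open>The backward bound is the same coupling with shift \<open>- d\<close>.\<close>
  have "g x \<le> ennreal (exp \<delta>) * f (x + - d)" for x
    using close[of "x - d"] by (simp add: close_def)
  then have "(\<integral>\<^sup>+x. g x \<partial>laplace b) \<le> ennreal (exp (\<delta> + \<bar>- d\<bar> / b)) * (\<integral>\<^sup>+x. f x \<partial>laplace b)"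
    using b by (intro nn_integral_laplace_exp_le) auto
  moreover have "(\<integral>\<^sup>+x. f x \<partial>laplace b) \<le> ennreal (exp (\<delta> + \<bar>d\<bar> / b)) * (\<integral>\<^sup>+x. g x \<partial>laplace b)"
    using b close by (intro nn_integral_laplace_exp_le) (auto simp: close_def)
  ultimately show ?thesis
    by (simp add: close_def)
qed

text \<open>Sequential composition for a discrete draw: the ratio of the two weights of
  \<open>y\<close> multiplies the ratio of what follows after \<open>y\<close>.\<close>

lemma nn_integral_pmf_exp_le:
  assumes "\<And>y. pmf p y \<le> exp a * pmf q y" and "\<And>y. f y \<le> ennreal (exp b) * g y"
  shows "(\<integral>\<^sup>+y. f y \<partial>measure_pmf p) \<le> ennreal (exp (a + b)) * (\<integral>\<^sup>+y. g y \<partial>measure_pmf q)"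
proof -
  have "ennreal (pmf p y) * f y \<le> ennreal (exp (a + b)) * (ennreal (pmf q y) * g y)" for y
  proof -
    have "ennreal (pmf p y) * f y \<le> (ennreal (exp a) * ennreal (pmf q y)) * (ennreal (exp b) * g y)"
      using assms by (intro mult_mono) (simp_all add: ennreal_leI flip: ennreal_mult)
    then show ?thesis
      by (simp add: exp_add ennreal_mult mult_ac)
  qed
  then show ?thesis
    unfolding nn_integral_measure_pmf by (intro nn_integral_exp_le) auto
qed

section \<open>The token loop as a sparse vector algorithm\<close>

text \<open>The weight of \<open>y\<close> and the normalizing sum each change by a factor of at
  most \<open>exp (\<epsilon> / 2)\<close>.\<close>

lemma pmf_exp_mechanism_le:
  assumes "\<epsilon> \<ge> 0" and "\<And>v. real (u v) \<le> real (u' v) + 1" and "\<And>v. real (u' v) \<le> real (u v) + 1"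
  shows "pmf (exp_mechanism \<epsilon> u) y \<le> exp \<epsilon> * pmf (exp_mechanism \<epsilon> u') y"
proof -
  define f where "f u v = exp (\<epsilon> * real (u v) / 2)" for u :: "'a \<Rightarrow> nat" and v
  have f_le: "f u v \<le> exp (\<epsilon> / 2) * f u' v"
    if "\<And>v. real (u v) \<le> real (u' v) + 1" for u u' v
    using mult_left_mono[OF that[of v] assms(1)]
    by (simp add: f_def algebra_simps flip: exp_add add_divide_distrib)
  have pos: "sum (f u) UNIV > 0" for u
    by (intro sum_pos) (auto simp: f_def)
  have "sum (f u') UNIV \<le> exp (\<epsilon> / 2) * sum (f u) UNIV"
    unfolding sum_distrib_left using assms(3) by (intro sum_mono f_le)
  then have "f u y * sum (f u') UNIV \<le> (exp (\<epsilon> / 2) * f u' y) * (exp (\<epsilon> / 2) * sum (f u) UNIV)"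
    using pos[of u'] assms(2) by (intro mult_mono f_le) (auto simp: f_def intro: sum_nonneg)
  also have "\<dots> = (exp (\<epsilon> / 2) * exp (\<epsilon> / 2)) * (f u' y * sum (f u) UNIV)"
    by (simp only: mult_ac)
  also have "exp (\<epsilon> / 2) * exp (\<epsilon> / 2) = exp \<epsilon>"
    by (simp flip: exp_add)
  finally show ?thesis
    using pos[of u] pos[of u'] by (simp add: pmf_exp_mechanism field_simps flip: f_def)
qed

text \<open>Only voter \<open>j\<close> can change its vote, so the voters for \<open>v\<close> in
  one run lie among those in the other run together with \<open>j\<close>.\<close>

lemma votes_le:
  assumes "\<And>i. i < m \<Longrightarrow> i \<noteq> j \<Longrightarrow> C i = C' i"
  shows "real (votes LLM x m C ys v) \<le> real (votes LLM x m C' ys v) + 1"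
proof -
  have "{i. i < m \<and> LLM x (C i) ys = v} \<subseteq> insert j {i. i < m \<and> LLM x (C' i) ys = v}"
    using assms by auto
  then have "votes LLM x m C ys v \<le> card (insert j {i. i < m \<and> LLM x (C' i) ys = v})"
    unfolding votes_def by (intro card_mono) auto
  also have "\<dots> \<le> Suc (votes LLM x m C' ys v)"
    unfolding votes_def by (rule card_insert_le_m1) auto
  finally show ?thesis by simp
qed

section \<open>Unfolding and measurability of the token loop\<close>

definition dprag_continue ::
    "'v::finite dprag_params \<Rightarrow> 'v llm \<Rightarrow> 'v list \<Rightarrow> (nat \<Rightarrow> 'v doc multiset) \<Rightarrow>
     nat \<Rightarrow> nat \<Rightarrow> real \<Rightarrow> 'v list \<Rightarrow> 'v list measure" where
  "dprag_continue P LLM x C n c h ys =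
     (if last ys = eos P \<or> c = 0 then return (count_space UNIV) ys else dprag_loop P LLM x C n c h ys)"

text \<open>The branch below the threshold. It has no threshold argument because a fresh threshold
  is drawn, so its integral is constant with respect to the noise of the current test.\<close>

definition dprag_discovery ::
    "'v::finite dprag_params \<Rightarrow> 'v llm \<Rightarrow> 'v list \<Rightarrow> (nat \<Rightarrow> 'v doc multiset) \<Rightarrow>
     nat \<Rightarrow> nat \<Rightarrow> 'v list \<Rightarrow> 'v list measure" where
  "dprag_discovery P LLM x C n c ys =
     measure_pmf (exp_mechanism (token_budget P / 2) (votes LLM x (voters P) C ys)) \<bind>
       (\<lambda>y. laplace (2 / (token_budget P / 2)) \<bind>
         (\<lambda>\<eta>. dprag_continue P LLM x C n (c - 1) (vote_threshold P + \<eta>) (ys @ [y])))"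

lemma dprag_loop_Suc:
  "dprag_loop P LLM x C (Suc n) c h ys =
     laplace (4 / (token_budget P / 2)) \<bind> (\<lambda>\<xi>.
       if real (votes LLM x (voters P) C ys (LLM x {#} ys)) + \<xi> \<le> h then dprag_discovery P LLM x C n c ys
       else dprag_continue P LLM x C n c h (ys @ [LLM x {#} ys]))"
  by (simp only: dprag_loop.simps Let_def dprag_discovery_def dprag_continue_def)

declare dprag_loop.simps(2) [simp del]

text \<open>Measurability of the loop is a hypothesis, because this fact is used within the
  induction on \<open>n\<close> that establishes it.\<close>

lemma measurable_dprag_continue:
  assumes "\<And>c ys. (\<lambda>h. dprag_loop P LLM x C n c h ys) \<in> borel \<rightarrow>\<^sub>M prob_algebra (count_space UNIV)"
  shows "(\<lambda>h. dprag_continue P LLM x C n c h ys) \<in> borel \<rightarrow>\<^sub>M prob_algebra (count_space UNIV)"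
  using assms by (cases "last ys = eos P \<or> c = 0")
    (auto simp: dprag_continue_def return_in_space_prob_algebra)

lemma dprag_discovery_in_space_prob_algebra:
  assumes "token_budget P > 0"
    and "\<And>c ys. (\<lambda>h. dprag_loop P LLM x C n c h ys) \<in> borel \<rightarrow>\<^sub>M prob_algebra (count_space UNIV)"
  shows "dprag_discovery P LLM x C n c ys \<in> space (prob_algebra (count_space UNIV))"
proof -
  have "(\<lambda>\<eta>. dprag_continue P LLM x C n (c - 1) (vote_threshold P + \<eta>) (ys @ [y]))
      \<in> borel \<rightarrow>\<^sub>M prob_algebra (count_space UNIV)" for y
    by (rule measurable_compose[OF _ measurable_dprag_continue[OF assms(2)]]) measurable
  then show ?thesis
    unfolding dprag_discovery_def using assms(1)
    by (intro bind_in_space_prob_algebra[OF measure_pmf_in_space_prob_algebra])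
      (auto intro!: bind_in_space_prob_algebra[OF laplace_in_space_prob_algebra])
qed

text \<open>The threshold is drawn from a continuous distribution, so the loop has to be a kernel in
  \<open>h\<close> before it can be bound to that draw.\<close>

lemma measurable_dprag_loop:
  assumes "token_budget P > 0"
  shows "(\<lambda>h. dprag_loop P LLM x C n c h ys) \<in> borel \<rightarrow>\<^sub>M prob_algebra (count_space UNIV)"
proof (induction n arbitrary: c ys)
  case 0
  then show ?case by (simp add: return_in_space_prob_algebra)
next
  case (Suc n)
  have [measurable]: "(\<lambda>h. dprag_continue P LLM x C n c h ys) \<in> borel \<rightarrow>\<^sub>M prob_algebra (count_space UNIV)"
    for ys
    by (rule measurable_dprag_continue[OF Suc.IH])
  have [measurable]: "(\<lambda>_. dprag_discovery P LLM x C n c ys) \<in> borel \<Otimes>\<^sub>M borel \<rightarrow>\<^sub>M prob_algebra (count_space UNIV)"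
    by (intro measurable_const dprag_discovery_in_space_prob_algebra[OF assms Suc.IH])
  show ?case
    unfolding dprag_loop_Suc
  proof (rule measurable_bind_prob_space2[where N = borel])
    show "(\<lambda>h. laplace (4 / (token_budget P / 2))) \<in> borel \<rightarrow>\<^sub>M prob_algebra borel"
      using assms by (intro measurable_const laplace_in_space_prob_algebra) simp
  qed measurable
qed

lemmas measurable_dprag_continue' = measurable_dprag_continue[OF measurable_dprag_loop]
lemmas dprag_discovery_in_space_prob_algebra' =
  dprag_discovery_in_space_prob_algebra[OF _ measurable_dprag_loop]

lemma nn_integral_dprag_discovery:
  assumes P: "token_budget P > 0"
  shows "(\<integral>\<^sup>+z. g z \<partial>dprag_discovery P LLM x C n c ys) =
    (\<integral>\<^sup>+y. \<integral>\<^sup>+\<eta>. \<integral>\<^sup>+z. g z \<partial>dprag_continue P LLM x C n (c - 1) (vote_threshold P + \<eta>) (ys @ [y])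
      \<partial>laplace (2 / (token_budget P / 2))
      \<partial>measure_pmf (exp_mechanism (token_budget P / 2) (votes LLM x (voters P) C ys)))"
proof -
  have m: "(\<lambda>\<eta>. dprag_continue P LLM x C n (c - 1) (vote_threshold P + \<eta>) (ys @ [y]))
      \<in> borel \<rightarrow>\<^sub>M prob_algebra (count_space UNIV)" for y
    by (rule measurable_compose[OF _ measurable_dprag_continue'[OF P]]) measurable
  have L: "laplace (2 / (token_budget P / 2)) \<in> space (prob_algebra borel)"
    using P by (intro laplace_in_space_prob_algebra) simp
  show ?thesis
    unfolding dprag_discovery_def nn_integral_bind_prob_algebra[OF L m, symmetric]
    by (rule nn_integral_bind_prob_algebra[OF measure_pmf_in_space_prob_algebra])
      (auto simp only: measurable_count_space_eq1 intro!: bind_in_space_prob_algebra[OF L m])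
qed

text \<open>The two outcomes of the test are separated because they call for different couplings of
  the noise: shifted in the first integral, unchanged in the second.\<close>

lemma nn_integral_dprag_loop_Suc:
  assumes P: "token_budget P > 0"
  shows "(\<integral>\<^sup>+z. g z \<partial>dprag_loop P LLM x C (Suc n) c h ys) =
    (\<integral>\<^sup>+\<xi>. (if real (votes LLM x (voters P) C ys (LLM x {#} ys)) + \<xi> \<le> h
       then \<integral>\<^sup>+z. g z \<partial>dprag_discovery P LLM x C n c ys else 0)
      \<partial>laplace (4 / (token_budget P / 2))) +
    (\<integral>\<^sup>+\<xi>. (if real (votes LLM x (voters P) C ys (LLM x {#} ys)) + \<xi> > h
       then \<integral>\<^sup>+z. g z \<partial>dprag_continue P LLM x C n c h (ys @ [LLM x {#} ys]) else 0)
      \<partial>laplace (4 / (token_budget P / 2)))"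
proof -
  let ?b = "LLM x {#} ys" and ?L = "laplace (4 / (token_budget P / 2))"
  let ?u = "real (votes LLM x (voters P) C ys ?b)"
  have "dprag_discovery P LLM x C n c ys \<in> space (prob_algebra (count_space UNIV))"
    by (rule dprag_discovery_in_space_prob_algebra'[OF P P])
  moreover have "dprag_continue P LLM x C n c h (ys @ [?b]) \<in> space (prob_algebra (count_space UNIV))"
    using measurable_space[OF measurable_dprag_continue'[OF P]] by simp
  ultimately have K: "(\<lambda>\<xi>. if ?u + \<xi> \<le> h then dprag_discovery P LLM x C n c ys
      else dprag_continue P LLM x C n c h (ys @ [?b])) \<in> borel \<rightarrow>\<^sub>M prob_algebra (count_space UNIV)"
    by (intro measurable_If measurable_const) auto
  have L: "?L \<in> space (prob_algebra borel)"
    using P by (intro laplace_in_space_prob_algebra) simp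
  show ?thesis
    unfolding dprag_loop_Suc nn_integral_bind_prob_algebra[OF L K]
    by (subst nn_integral_add[symmetric]) (auto intro!: nn_integral_cong)
qed

text \<open>Sparse vector: the threshold of the second run is lowered by one, so a query that passes in the
  first run passes in the second with the same noise. The cost \<open>token_budget P / 4\<close> of that shift is
  missing from the bound because it is paid where the threshold is drawn.\<close>

lemma dprag_loop_exp_le:
  assumes P: "token_budget P > 0" and eq: "\<And>i. i < voters P \<Longrightarrow> i \<noteq> j \<Longrightarrow> C i = C' i" and "c > 0"
  shows "(\<integral>\<^sup>+z. g z \<partial>dprag_loop P LLM x C n c h ys) \<le>
    ennreal (exp (real c * token_budget P - token_budget P / 4)) *
      (\<integral>\<^sup>+z. g z \<partial>dprag_loop P LLM x C' n c (h - 1) ys)"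
  using \<open>c > 0\<close>
proof (induction n arbitrary: c h ys)
  case 0
  \<comment> \<open>Both runs return \<open>ys\<close>, so a nonnegative exponent suffices; it is
    nonnegative because \<open>c \<ge> 1\<close>.\<close>
  have "token_budget P / 4 \<le> 1 * token_budget P"
    using P by simp
  also have "\<dots> \<le> real c * token_budget P"
    using 0 P by (intro mult_right_mono) auto
  finally have "g ys \<le> ennreal (exp (real c * token_budget P - token_budget P / 4)) * g ys"
    using exp_le_mono[of "g ys" 0 "g ys"] by simp
  then show ?case by (simp add: nn_integral_return)
next
  case (Suc n)
  let ?e = "token_budget P"
  \<comment> \<open>One discovery costs \<open>?e\<close>: \<open>?e / 2\<close> for the exponential
    mechanism, \<open>?e / 4\<close> for shifting the noise of the test and \<open>?e / 4\<close>
    for shifting the threshold. \<open>K\<close> leaves out the last share for the threshold in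
    force.\<close>
  define K where "K = real c * ?e - ?e / 4"
  define u where "u = votes LLM x (voters P) C ys"
  define u' where "u' = votes LLM x (voters P) C' ys"
  have u: "real (u v) \<le> real (u' v) + 1" "real (u' v) \<le> real (u v) + 1" for v
    unfolding u_def u'_def using votes_le[of "voters P" j C C'] votes_le[of "voters P" j C' C] eq by auto
  \<comment> \<open>For \<open>c = 0\<close> both runs stop and no threshold is in force, so there
    is no share to leave out.\<close>
  have cont: "(\<integral>\<^sup>+z. g z \<partial>dprag_continue P LLM x C n c h ys) \<le>
      ennreal (exp (real c * ?e - (if c = 0 then 0 else ?e / 4))) *
      (\<integral>\<^sup>+z. g z \<partial>dprag_continue P LLM x C' n c (h - 1) ys)" for c h ys
  proof (cases "last ys = eos P \<or> c = 0")
    case True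
    have "real c * ?e - (if c = 0 then 0 else ?e / 4) \<ge> 0"
    proof (cases "c = 0")
      case False
      then have "1 * ?e \<le> real c * ?e"
        using P by (intro mult_right_mono) auto
      with P False show ?thesis by simp
    qed simp
    then have "g ys \<le> ennreal (exp (real c * ?e - (if c = 0 then 0 else ?e / 4))) * g ys"
      using exp_le_mono[of "g ys" 0 "g ys"] by simp
    with True show ?thesis by (simp add: dprag_continue_def nn_integral_return)
  next
    case False
    then show ?thesis using Suc.IH[of c h ys] by (simp add: dprag_continue_def)
  qed
  have meas: "(\<lambda>h. \<integral>\<^sup>+z. g z \<partial>dprag_continue P LLM x C n c h ys) \<in> borel_measurable borel" for C c ys
    by (rule measurable_nn_integral_prob_algebra[OF measurable_dprag_continue'[OF P]]) simp
  have disc: "(\<integral>\<^sup>+z. g z \<partial>dprag_discovery P LLM x C n c ys) \<le>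
      ennreal (exp (K - ?e / 4)) * (\<integral>\<^sup>+z. g z \<partial>dprag_discovery P LLM x C' n c ys)"
  proof -
    have "(\<integral>\<^sup>+\<eta>. \<integral>\<^sup>+z. g z \<partial>dprag_continue P LLM x C n (c - 1) (vote_threshold P + \<eta>) (ys @ [y]) \<partial>laplace (2 / (?e / 2)))
      \<le> ennreal (exp (real (c - 1) * ?e)) *
        (\<integral>\<^sup>+\<eta>. \<integral>\<^sup>+z. g z \<partial>dprag_continue P LLM x C' n (c - 1) (vote_threshold P + \<eta>) (ys @ [y]) \<partial>laplace (2 / (?e / 2)))"
      (is "?l \<le> _ * ?r") for y
    proof (cases "c - 1 = 0")
      case True
      then show ?thesis by (simp add: dprag_continue_def)
    next
      case False
      \<comment> \<open>The fresh threshold noise of the second run is lowered by one. At scale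
        \<open>4 / ?e\<close> this costs \<open>?e / 4\<close>, exactly what \<open>cont\<close>
        leaves out.\<close>
      have "?l \<le> ennreal (exp (real (c - 1) * ?e - ?e / 4 + \<bar>-1\<bar> / (2 / (?e / 2)))) * ?r"
      proof (rule nn_integral_laplace_exp_le)
        fix \<eta>
        show "(\<integral>\<^sup>+z. g z \<partial>dprag_continue P LLM x C n (c - 1) (vote_threshold P + \<eta>) (ys @ [y])) \<le>
          ennreal (exp (real (c - 1) * ?e - ?e / 4)) *
          (\<integral>\<^sup>+z. g z \<partial>dprag_continue P LLM x C' n (c - 1) (vote_threshold P + (\<eta> + - 1)) (ys @ [y]))"
          using cont[of "c - 1" "vote_threshold P + \<eta>" "ys @ [y]"] False by (simp add: algebra_simps)
      next
        show "(\<lambda>\<eta>. \<integral>\<^sup>+z. g z \<partial>dprag_continue P LLM x C' n (c - 1) (vote_threshold P + \<eta>) (ys @ [y]))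
          \<in> borel_measurable borel"
          by (rule measurable_compose[OF _ meas]) measurable
      qed (use P in simp)
      also have "real (c - 1) * ?e - ?e / 4 + \<bar>-1\<bar> / (2 / (?e / 2)) = real (c - 1) * ?e"
        by simp
      finally show ?thesis .
    qed
    then have "(\<integral>\<^sup>+z. g z \<partial>dprag_discovery P LLM x C n c ys) \<le>
      ennreal (exp (?e / 2 + real (c - 1) * ?e)) * (\<integral>\<^sup>+z. g z \<partial>dprag_discovery P LLM x C' n c ys)"
      unfolding nn_integral_dprag_discovery[OF P]
      using P u by (intro nn_integral_pmf_exp_le pmf_exp_mechanism_le) (auto simp: u_def u'_def)
    also have "?e / 2 + real (c - 1) * ?e = K - ?e / 4"
      using Suc.prems by (simp add: K_def of_nat_diff algebra_simps)
    finally show ?thesis .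
  qed
  define b where "b = LLM x {#} ys"
  \<comment> \<open>This shift aligns the tests: \<open>u b + \<xi> \<le> h\<close> iff
    \<open>u' b + (\<xi> + d) \<le> h - 1\<close>. As \<open>\<bar>d\<bar> \<le> 2\<close> and the
    noise has scale \<open>8 / ?e\<close>, it costs at most \<open>?e / 4\<close>.\<close>
  define d where "d = real (u b) - real (u' b) - 1"
  have d: "\<bar>d\<bar> \<le> 2"
    using u[of b] by (simp add: d_def)
  show ?case
    unfolding nn_integral_dprag_loop_Suc[OF P] distrib_left u_def[symmetric] u'_def[symmetric]
      b_def[symmetric] K_def[symmetric]
  proof (rule add_mono)
    have "(\<integral>\<^sup>+\<xi>. (if real (u b) + \<xi> \<le> h then \<integral>\<^sup>+z. g z \<partial>dprag_discovery P LLM x C n c ys else 0)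
        \<partial>laplace (4 / (?e / 2))) \<le>
      ennreal (exp (K - ?e / 4 + \<bar>d\<bar> / (4 / (?e / 2)))) *
      (\<integral>\<^sup>+\<xi>. (if real (u' b) + \<xi> \<le> h - 1 then \<integral>\<^sup>+z. g z \<partial>dprag_discovery P LLM x C' n c ys else 0)
        \<partial>laplace (4 / (?e / 2)))"
      using disc P by (intro nn_integral_laplace_exp_le) (auto simp: d_def)
    then show "(\<integral>\<^sup>+\<xi>. (if real (u b) + \<xi> \<le> h then \<integral>\<^sup>+z. g z \<partial>dprag_discovery P LLM x C n c ys else 0)
        \<partial>laplace (4 / (?e / 2))) \<le>
      ennreal (exp K) *
      (\<integral>\<^sup>+\<xi>. (if real (u' b) + \<xi> \<le> h - 1 then \<integral>\<^sup>+z. g z \<partial>dprag_discovery P LLM x C' n c ys else 0)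
        \<partial>laplace (4 / (?e / 2)))"
    proof (rule exp_le_mono)
      show "K - ?e / 4 + \<bar>d\<bar> / (4 / (?e / 2)) \<le> K"
        using mult_right_mono[OF d, of ?e] P by simp
    qed
    show "(\<integral>\<^sup>+\<xi>. (if h < real (u b) + \<xi>
          then \<integral>\<^sup>+z. g z \<partial>dprag_continue P LLM x C n c h (ys @ [b]) else 0) \<partial>laplace (4 / (?e / 2))) \<le>
      ennreal (exp K) *
      (\<integral>\<^sup>+\<xi>. (if h - 1 < real (u' b) + \<xi>
          then \<integral>\<^sup>+z. g z \<partial>dprag_continue P LLM x C' n c (h - 1) (ys @ [b]) else 0) \<partial>laplace (4 / (?e / 2)))"
    \<comment> \<open>With equal noise a pass in the first run is a pass in the second, since
      \<open>u' b \<ge> u b - 1\<close>, so passing adds no cost. The converse may fail, which is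
      why the bound is one-sided.\<close>
    proof (rule nn_integral_exp_le)
      fix \<xi> :: real
      show "(if h < real (u b) + \<xi> then \<integral>\<^sup>+z. g z \<partial>dprag_continue P LLM x C n c h (ys @ [b]) else 0) \<le>
        ennreal (exp K) *
        (if h - 1 < real (u' b) + \<xi>
          then \<integral>\<^sup>+z. g z \<partial>dprag_continue P LLM x C' n c (h - 1) (ys @ [b]) else 0)"
        using u(1)[of b] cont[of c h "ys @ [b]"] Suc.prems by (auto simp: K_def)
    qed measurable
  qed
qed

section \<open>Retrieval and random splits\<close>

abbreviation rank_sorted :: "('v doc \<Rightarrow> real) \<Rightarrow> 'v entry list \<Rightarrow> bool" where
  "rank_sorted f \<equiv> sorted_wrt (\<lambda>e e'. rank f e \<ge> rank f e')"

lemma rank_sorted_iff: "rank_sorted f xs \<longleftrightarrow> sorted (map (\<lambda>e. - rank f e) xs)"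
  by (simp add: sorted_map)

text \<open>Sorted lists with the same multiset have the same sequence of keys, and an injective
  rank recovers the entries from the keys. Repetitions of one entry, such as padding, do no
  harm.\<close>

lemma rank_sorted_unique:
  assumes "mset xs = mset ys" and "rank_sorted f xs" and "rank_sorted f ys" and "inj_on (rank f) (set xs)"
  shows "xs = ys"
proof (rule map_inj_on)
  let ?key = "\<lambda>e. - rank f e"
  show "map ?key xs = map ?key ys"
    using properties_for_sort[of "map ?key xs" "map ?key ys"]
      properties_for_sort[of "map ?key ys" "map ?key ys"] assms(1-3)
    unfolding rank_sorted_iff by simp
  show "inj_on ?key (set xs \<union> set ys)"
    using assms(4) mset_eq_setD[OF assms(1)] by (simp add: inj_on_def)
qed

lemma ex_rank_sorted: "\<exists>xs. mset xs = X \<and> rank_sorted f xs"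
proof -
  obtain ys where ys: "mset ys = X"
    using ex_mset by blast
  have "rank_sorted f (sort_key (\<lambda>e. - rank f e) ys)"
    unfolding rank_sorted_iff by simp
  with ys show ?thesis by (metis mset_sort)
qed

text \<open>Uniqueness of the sorted arrangement identifies the list chosen inside
  \<open>topk\<close> with any sorted arrangement at hand.\<close>

lemma topk_eq:
  assumes "mset xs = X" and "rank_sorted f xs" and "inj_on (rank f) (set_mset X)"
  shows "topk X K f = take K (xs @ replicate K None)"
proof -
  have "mset (SOME xs. mset xs = X \<and> rank_sorted f xs) = X \<and>
      rank_sorted f (SOME xs. mset xs = X \<and> rank_sorted f xs)"
    using ex_rank_sorted by (rule someI_ex)
  then have "(SOME xs. mset xs = X \<and> rank_sorted f xs) = xs"
    using assms by (intro rank_sorted_unique) (auto simp: set_mset_mset[symmetric] simp del: set_mset_mset)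
  then show ?thesis by (simp add: topk_def)
qed

text \<open>MuRAG-Ada retrieves \<open>k\<close> entries and the single-query algorithm retrieves
  \<open>K\<close> from these. Padding ranks lowest, so the first result is already sorted, and the
  second retrieval only truncates it or appends more padding.\<close>

lemma topk_topk:
  assumes "mset xs = X" and "rank_sorted f xs" and inj: "inj_on (rank f) (insert None (set_mset X))"
  shows "topk (mset (topk X k f)) K f =
    take (min k K) (xs @ replicate k None) @ replicate (K - k) None"
proof -
  have 1: "topk X k f = take k (xs @ replicate k None)"
    using assms by (intro topk_eq) (auto intro: inj_on_subset)
  have "rank_sorted f (replicate k None)"
    by (induction k) auto
  then have "rank_sorted f (xs @ replicate k None)"
    using assms(2) by (auto simp: sorted_wrt_append)
  then have "rank_sorted f (topk X k f)"
    unfolding 1 by (rule sorted_wrt_take)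
  moreover have "set (topk X k f) \<subseteq> insert None (set_mset X)"
    unfolding 1 using assms(1) by (auto dest!: in_set_takeD)
  ultimately have "topk (mset (topk X k f)) K f = take K (topk X k f @ replicate K None)"
    by (intro topk_eq) (auto intro: inj_on_subset[OF inj])
  then show ?thesis
    by (auto simp: 1 min_def)
qed

text \<open>The lists are compared as multisets, because a uniformly random split does not see
  positions.\<close>

definition one_swap :: "'a list \<Rightarrow> 'a list \<Rightarrow> bool" where
  "one_swap U V \<longleftrightarrow> (\<exists>W e e'. mset U = add_mset e W \<and> mset V = add_mset e' W)"

lemma one_swap_sym: "one_swap U V \<Longrightarrow> one_swap V U"
  unfolding one_swap_def by blast

lemma one_swap_append: "one_swap U V \<Longrightarrow> one_swap (U @ Z) (V @ Z)"
  unfolding one_swap_def by (metis mset_append union_mset_add_mset_left)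

text \<open>If \<open>z\<close> falls within the first \<open>n\<close> positions, it displaces the
  last entry that was retained; otherwise the prefix does not change.\<close>

lemma one_swap_take_insert:
  assumes "n \<le> length (xs @ ys)"
  shows "take n (xs @ ys) = take n (xs @ z # ys) \<or> one_swap (take n (xs @ ys)) (take n (xs @ z # ys))"
proof (cases "n \<le> length xs")
  case False
  \<comment> \<open>The prefix reaches \<open>Suc j\<close> entries past \<open>xs\<close>:
    \<open>ys ! j\<close> is the entry pushed out by \<open>z\<close>, and
    \<open>xs @ take j ys\<close> is common to both prefixes.\<close>
  then obtain j where n: "n = length xs + Suc j"
    by (metis add_Suc_right less_iff_Suc_add not_le)
  with assms have "take n (xs @ ys) = xs @ take j ys @ [ys ! j]"
    by (simp add: take_Suc_conv_app_nth)
  moreover have "take n (xs @ z # ys) = xs @ z # take j ys"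
    by (simp add: n)
  ultimately show ?thesis
    unfolding one_swap_def by (intro disjI2 exI[of _ "mset (xs @ take j ys)"]) simp
qed simp

text \<open>Deleting \<open>z\<close> from a sorted arrangement of the larger multiset sorts the
  smaller one. The retrieved lists are thus prefixes of two lists that differ by one insertion,
  followed by the same padding.\<close>

lemma topk_topk_add_mset:
  assumes "inj_on (rank f) (insert None (set_mset (add_mset z X)))"
  shows "topk (mset (topk X k f)) K f = topk (mset (topk (add_mset z X) k f)) K f \<or>
    one_swap (topk (mset (topk X k f)) K f) (topk (mset (topk (add_mset z X) k f)) K f)"
proof -
  obtain zs where zs: "mset zs = add_mset z X" "rank_sorted f zs"
    using ex_rank_sorted by blast
  then have "z \<in> set zs"
    by (metis set_mset_mset union_single_eq_member)
  then obtain xs ys where split: "zs = xs @ z # ys"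
    by (meson split_list)
  have "mset (xs @ ys) = X" "rank_sorted f (xs @ ys)"
    using zs by (auto simp: split sorted_wrt_append)
  then have "topk (mset (topk X k f)) K f =
      take (min k K) (xs @ (ys @ replicate k None)) @ replicate (K - k) None"
    using assms by (subst topk_topk[of "xs @ ys"]) (auto intro: inj_on_subset)
  moreover have "topk (mset (topk (add_mset z X) k f)) K f =
      take (min k K) (xs @ z # (ys @ replicate k None)) @ replicate (K - k) None"
    using topk_topk[OF zs assms] by (simp only: split append.simps append_assoc)
  moreover have "min k K \<le> length (xs @ (ys @ replicate k None))"
    by simp
  ultimately show ?thesis
    using one_swap_take_insert one_swap_append by metis
qed

section \<open>Symmetry of the random split\<close>

lemma comp_permutes_in_splits:
  assumes "\<sigma> \<in> splits m l" and p: "p permutes {..<m * l}"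
  shows "\<sigma> \<circ> p \<in> splits m l"
proof -
  have lt: "p j < m * l \<longleftrightarrow> j < m * l" for j
    using permutes_in_image[OF p, of j] by simp
  have "card {j. j < m * l \<and> (\<sigma> \<circ> p) j = i} = card {j. j < m * l \<and> \<sigma> j = i}" for i
  proof -
    have "p ` {j. j < m * l \<and> (\<sigma> \<circ> p) j = i} = {j. j < m * l \<and> \<sigma> j = i}"
      using lt permutes_surj[OF p] by (auto simp: image_iff) (metis surjD)
    then show ?thesis
      using card_image[OF inj_on_subset[OF permutes_inj[OF p] subset_UNIV]] by metis
  qed
  moreover have "\<sigma> \<circ> p \<in> {..<m * l} \<rightarrow>\<^sub>E {..<m}"
    using assms(1) lt permutes_not_in[OF p]
    by (auto simp: splits_def PiE_iff extensional_def)
  ultimately show ?thesis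
    using assms(1) by (simp add: splits_def)
qed

text \<open>Composition with \<open>inv p\<close> is the inverse map, so composition with
  \<open>p\<close> permutes the finite set of splits and preserves the uniform distribution.\<close>

lemma map_pmf_of_set_splits:
  assumes p: "p permutes {..<m * l}"
  shows "map_pmf (\<lambda>\<sigma>. \<sigma> \<circ> p) (pmf_of_set (splits m l)) = pmf_of_set (splits m l)"
proof (rule map_pmf_of_set_bij_betw[OF _ splits_nonempty finite_splits])
  show "bij_betw (\<lambda>\<sigma>. \<sigma> \<circ> p) (splits m l) (splits m l)"
    using comp_permutes_in_splits[OF _ p] comp_permutes_in_splits[OF _ permutes_inv[OF p]]
    by (intro bij_betw_byWitness[where f' = "\<lambda>\<sigma>. \<sigma> \<circ> inv p"])
      (auto simp: comp_assoc permutes_inv_o[OF p])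
qed

text \<open>Position \<open>j\<close> of the permuted list holds \<open>X ! p j\<close> and is sent
  to the chunk of \<open>p j\<close>, so only the names of the positions change.\<close>

lemma chunk_permute_list:
  assumes p: "p permutes {..<length X}"
  shows "chunk X \<sigma> i = chunk (permute_list p X) (\<sigma> \<circ> p) i"
proof -
  have lt: "p j < length X \<longleftrightarrow> j < length X" for j
    using permutes_in_image[OF p, of j] by simp
  have "{j. j < length X \<and> \<sigma> j = i} = p ` {j. j < length X \<and> \<sigma> (p j) = i}"
    using lt permutes_surj[OF p] by (auto simp: image_iff) (metis surjD)
  moreover have "inj_on p A" for A
    using permutes_inj[OF p] by (rule inj_on_subset) simp
  ultimately have "mset_set {j. j < length X \<and> \<sigma> j = i} =
      image_mset p (mset_set {j. j < length X \<and> \<sigma> (p j) = i})"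
    by (simp add: image_mset_mset_set)
  then show ?thesis
    unfolding chunk_def
    by (auto simp: multiset.map_comp permute_list_nth[OF p] intro!: image_mset_cong)
qed

lemma chunk_list_update:
  assumes "\<sigma> j \<noteq> i"
  shows "chunk (X[j := e]) \<sigma> i = chunk X \<sigma> i"
proof -
  have "X[j := e] ! j' = X ! j'" if "\<sigma> j' = i" for j'
    using assms that by (cases "j = j'") auto
  then show ?thesis
    unfolding chunk_def by (auto intro!: image_mset_cong)
qed

text \<open>Overwriting \<open>e\<close> by \<open>e'\<close> at position \<open>j\<close> of
  \<open>X\<close> yields a rearrangement of \<open>X'\<close> by \<open>p\<close>. Only the chunk
  containing that position, which has index \<open>\<sigma> (p j)\<close>, can notice the
  overwriting.\<close>

lemma one_swap_chunk:
  assumes "one_swap X X'" and "length X = N"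
  obtains p j where "p permutes {..<N}"
    "\<And>\<sigma> i. \<sigma> (p j) \<noteq> i \<Longrightarrow> chunk X (\<sigma> \<circ> p) i = chunk X' \<sigma> i"
proof -
  obtain W e e' where W: "mset X = add_mset e W" "mset X' = add_mset e' W"
    using assms(1) unfolding one_swap_def by blast
  then have "e \<in> set X"
    by (metis set_mset_mset union_single_eq_member)
  then obtain j where j: "j < length X" "X ! j = e"
    by (auto simp: in_set_conv_nth)
  then have "mset (X[j := e']) = mset X'"
    using W by (simp add: mset_update)
  then obtain p where p: "p permutes {..<length X'}" "permute_list p X' = X[j := e']"
    using mset_eq_permutation by blast
  have "length X' = N"
    using W assms(2) by (metis size_add_mset size_mset)
  moreover have "chunk X (\<sigma> \<circ> p) i = chunk X' \<sigma> i" if "\<sigma> (p j) \<noteq> i" for \<sigma> i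
    using that chunk_list_update[of "\<sigma> \<circ> p" j i X e'] chunk_permute_list[OF p(1), of \<sigma> i] p(2)
    by simp
  ultimately show ?thesis
    using that p(1) by blast
qed

section \<open>Privacy of the single-query algorithm\<close>

lemma measurable_bind_measure_pmf_finite:
  assumes fin: "finite (set_pmf p)" and K: "\<And>x. (\<lambda>y. K y x) \<in> M \<rightarrow>\<^sub>M prob_algebra N"
  shows "(\<lambda>y. measure_pmf p \<bind> K y) \<in> M \<rightarrow>\<^sub>M prob_algebra N"
proof -
  have Ky: "K y \<in> count_space UNIV \<rightarrow>\<^sub>M prob_algebra N" if "y \<in> space M" for y
    using measurable_space[OF K that] by simp
  then have bind: "measure_pmf p \<bind> K y \<in> space (prob_algebra N)" if "y \<in> space M" for y
    using that by (intro bind_in_space_prob_algebra[OF measure_pmf_in_space_prob_algebra])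
  show ?thesis
  proof (intro measurable_prob_algebraI measurable_subprob_algebra)
    fix S assume S: "S \<in> sets N"
    \<comment> \<open>A finite support turns the mixture into a finite sum, so measurability in
      \<open>y\<close> for each fixed \<open>x\<close> suffices.\<close>
    have "emeasure (measure_pmf p \<bind> K y) S = (\<Sum>x\<in>set_pmf p. emeasure (K y x) S * pmf p x)"
      if "y \<in> space M" for y
      using emeasure_bind_prob_algebra[OF measure_pmf_in_space_prob_algebra Ky[OF that] S]
        nn_integral_measure_pmf_finite[OF fin] by simp
    moreover have "(\<lambda>y. emeasure (K y x) S) \<in> borel_measurable M" for x
      using measurable_compose[OF measurable_prob_algebraD[OF K] measurable_emeasure_subprob_algebra[OF S]] .
    ultimately show "(\<lambda>y. emeasure (measure_pmf p \<bind> K y) S) \<in> borel_measurable M"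
      by (subst measurable_cong) auto
  qed (use bind in \<open>auto simp: space_prob_algebra prob_space_imp_subprob_space\<close>)
qed

lemma measurable_dprag_split:
  assumes "token_budget P > 0"
  shows "(\<lambda>\<eta>. measure_pmf (pmf_of_set (splits m l)) \<bind> (\<lambda>\<sigma>. dprag_loop P LLM x (C \<sigma>) n c (\<theta> + \<eta>) ys))
    \<in> borel \<rightarrow>\<^sub>M prob_algebra (count_space UNIV)"
proof (rule measurable_bind_measure_pmf_finite)
  show "finite (set_pmf (pmf_of_set (splits m l)))"
    by (simp add: finite_splits splits_nonempty)
  show "(\<lambda>\<eta>. dprag_loop P LLM x (C \<sigma>) n c (\<theta> + \<eta>) ys) \<in> borel \<rightarrow>\<^sub>M prob_algebra (count_space UNIV)" for \<sigma>
    by (rule measurable_compose[OF _ measurable_dprag_loop[OF assms]]) measurable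
qed

lemma dprag_in_space_prob_algebra:
  assumes "token_budget P > 0"
  shows "dprag P r x X LLM \<epsilon> \<in> space (prob_algebra (count_space UNIV))"
  unfolding dprag_def Let_def using assms
  by (auto intro!: return_in_space_prob_algebra measurable_dprag_split
      bind_in_space_prob_algebra[OF laplace_in_space_prob_algebra])

lemma nn_integral_dprag:
  assumes P: "token_budget P > 0" and "nat \<lfloor>\<epsilon> / token_budget P\<rfloor> \<noteq> 0"
  shows "(\<integral>\<^sup>+z. g z \<partial>dprag P r x X LLM \<epsilon>) =
    (\<integral>\<^sup>+\<eta>. \<integral>\<^sup>+\<sigma>. \<integral>\<^sup>+z. g z
      \<partial>dprag_loop P LLM x (chunk (topk X (voters P * docs_per_voter P) (\<lambda>z. r z x)) \<sigma>)
        (max_tokens P) (nat \<lfloor>\<epsilon> / token_budget P\<rfloor>) (vote_threshold P + \<eta>) []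
      \<partial>measure_pmf (pmf_of_set (splits (voters P) (docs_per_voter P)))
      \<partial>laplace (2 / (token_budget P / 2)))"
proof -
  have L: "laplace (2 / (token_budget P / 2)) \<in> space (prob_algebra borel)"
    using P by (intro laplace_in_space_prob_algebra) simp
  have "(\<lambda>\<sigma>. dprag_loop P LLM x (C \<sigma>) n c h ys) \<in> count_space UNIV \<rightarrow>\<^sub>M prob_algebra (count_space UNIV)"
    for C :: "(nat \<Rightarrow> nat) \<Rightarrow> nat \<Rightarrow> 'a doc multiset" and n c h ys
    using measurable_space[OF measurable_dprag_loop[OF P]] by simp
  then show ?thesis
    unfolding dprag_def Let_def if_not_P[OF assms(2)]
    by (simp only: nn_integral_bind_prob_algebra[OF L measurable_dprag_split[OF P]]
        nn_integral_bind_prob_algebra[OF measure_pmf_in_space_prob_algebra])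
qed

text \<open>A uniformly random split is invariant under permutations of the positions, so the two runs can be
  coupled such that the replaced entry affects a single voter.\<close>

lemma dprag_exp_le:
  assumes P: "token_budget P > 0" and "\<epsilon> \<ge> 0"
    and swap: "one_swap (topk X (voters P * docs_per_voter P) (\<lambda>z. r z x))
      (topk X' (voters P * docs_per_voter P) (\<lambda>z. r z x))"
  shows "(\<integral>\<^sup>+z. g z \<partial>dprag P r x X LLM \<epsilon>) \<le> ennreal (exp \<epsilon>) * (\<integral>\<^sup>+z. g z \<partial>dprag P r x X' LLM \<epsilon>)"
proof (cases "nat \<lfloor>\<epsilon> / token_budget P\<rfloor> = 0")
  case True
  then show ?thesis
    using exp_le_mono[of "g []" 0 "g []" \<epsilon>] \<open>\<epsilon> \<ge> 0\<close> by (simp add: dprag_def nn_integral_return)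
next
  case False
  let ?e = "token_budget P"
  define c where "c = nat \<lfloor>\<epsilon> / ?e\<rfloor>"
  define m where "m = voters P"
  define l where "l = docs_per_voter P"
  define F where "F X = topk X (m * l) (\<lambda>z. r z x)" for X
  define V where "V X \<sigma> h =
    (\<integral>\<^sup>+z. g z \<partial>dprag_loop P LLM x (chunk (F X) \<sigma>) (max_tokens P) c h [])" for X \<sigma> h
  define p where "p = pmf_of_set (splits m l)"
  \<comment> \<open>The floor in \<open>c\<close> is what makes \<open>c\<close> discoveries of cost
    \<open>?e\<close> fit into \<open>\<epsilon>\<close>.\<close>
  have c: "c > 0" "real c * ?e \<le> \<epsilon>"
  proof -
    show "c > 0"
      using False by (simp add: c_def)
    have "real c \<le> \<epsilon> / ?e"
      using P \<open>\<epsilon> \<ge> 0\<close> by (simp add: c_def of_nat_nat)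
    then show "real c * ?e \<le> \<epsilon>"
      using P by (simp add: field_simps)
  qed
  have "one_swap (F X) (F X')" "length (F X) = m * l"
    using swap by (simp_all add: F_def m_def l_def length_topk)
  then obtain \<pi> j where \<pi>: "\<pi> permutes {..<m * l}"
    "\<And>\<sigma> i. \<sigma> (\<pi> j) \<noteq> i \<Longrightarrow> chunk (F X) (\<sigma> \<circ> \<pi>) i = chunk (F X') \<sigma> i"
    using one_swap_chunk by metis
  \<comment> \<open>The replaced entry reaches only voter \<open>\<sigma> (\<pi> j)\<close>; every
    other voter receives the same chunk in both runs.\<close>
  have V_le: "V X (\<sigma> \<circ> \<pi>) h \<le> ennreal (exp (real c * ?e - ?e / 4)) * V X' \<sigma> (h - 1)" for \<sigma> h
    unfolding V_def using c(1) \<pi>(2) by (intro dprag_loop_exp_le[OF P, where j = "\<sigma> (\<pi> j)"]) auto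
  have "(\<integral>\<^sup>+\<sigma>. V X \<sigma> h \<partial>measure_pmf p)
      \<le> ennreal (exp (real c * ?e - ?e / 4)) * (\<integral>\<^sup>+\<sigma>. V X' \<sigma> (h - 1) \<partial>measure_pmf p)" for h
  proof -
    have "(\<integral>\<^sup>+\<sigma>. V X \<sigma> h \<partial>measure_pmf p) = (\<integral>\<^sup>+\<sigma>. V X (\<sigma> \<circ> \<pi>) h \<partial>measure_pmf p)"
      unfolding p_def by (subst map_pmf_of_set_splits[OF \<pi>(1), symmetric]) simp
    then show ?thesis
      using nn_integral_exp_le[of "measure_pmf p", OF V_le] by simp
  qed
  moreover have "(\<lambda>\<eta>. \<integral>\<^sup>+\<sigma>. V X' \<sigma> (vote_threshold P + \<eta>) \<partial>measure_pmf p) \<in> borel_measurable borel"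
  proof -
    have "dprag_loop P LLM x C n c h ys \<in> space (prob_algebra (count_space UNIV))" for C n c h ys
      using measurable_space[OF measurable_dprag_loop[OF P]] by simp
    then show ?thesis
      using measurable_nn_integral_prob_algebra[OF measurable_dprag_split[OF P,
        of m l LLM x "chunk (F X')" "max_tokens P" c "vote_threshold P" "[]"], of g]
      by (simp add: V_def p_def
          nn_integral_bind_prob_algebra[OF measure_pmf_in_space_prob_algebra])
  qed
  \<comment> \<open>Lowering the initial threshold noise by one costs the \<open>?e / 4\<close>
    still missing, for a total of \<open>real c * ?e\<close>.\<close>
  ultimately have "(\<integral>\<^sup>+\<eta>. \<integral>\<^sup>+\<sigma>. V X \<sigma> (vote_threshold P + \<eta>) \<partial>measure_pmf p \<partial>laplace (2 / (?e / 2))) \<le>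
      ennreal (exp (real c * ?e - ?e / 4 + \<bar>-1\<bar> / (2 / (?e / 2)))) *
      (\<integral>\<^sup>+\<eta>. \<integral>\<^sup>+\<sigma>. V X' \<sigma> (vote_threshold P + \<eta>) \<partial>measure_pmf p \<partial>laplace (2 / (?e / 2)))"
    using P by (intro nn_integral_laplace_exp_le) (auto simp: add_diff_eq)
  then show ?thesis
    unfolding nn_integral_dprag[OF P False] V_def p_def F_def c_def m_def l_def
    by (rule exp_le_mono) (use c(2) in \<open>simp add: c_def\<close>)
qed

lemma close_dprag:
  assumes "token_budget P > 0" and "\<epsilon> \<ge> 0"
    and "one_swap (topk X (voters P * docs_per_voter P) (\<lambda>z. r z x))
      (topk X' (voters P * docs_per_voter P) (\<lambda>z. r z x))"
  shows "close \<epsilon> (\<integral>\<^sup>+z. g z \<partial>dprag P r x X LLM \<epsilon>) (\<integral>\<^sup>+z. g z \<partial>dprag P r x X' LLM \<epsilon>)"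
  unfolding close_def using assms by (auto intro: dprag_exp_le one_swap_sym)

section \<open>Individual privacy budgets\<close>

definition bin_docs ::
    "(nat \<Rightarrow> real) \<Rightarrow> ('v doc \<Rightarrow> real) \<Rightarrow> real \<Rightarrow> 'v doc set \<Rightarrow> nat \<Rightarrow> ('v doc \<Rightarrow> real) \<Rightarrow> 'v doc set" where
  "bin_docs a f \<epsilon>_thr D i E = {z \<in> D. f z \<in> {a i..<a (Suc i)} \<and> E z \<ge> \<epsilon>_thr}"

lemma threshold_loop_Cons:
  "threshold_loop a f \<epsilon>_thr k D (i # is) E s A =
     laplace (1 / \<epsilon>_thr) \<bind> (\<lambda>\<xi>.
       if s + real (card (bin_docs a f \<epsilon>_thr D i E)) + \<xi> \<ge> real k
       then return (count_space UNIV) (charge \<epsilon>_thr (bin_docs a f \<epsilon>_thr D i E) E, A \<union> bin_docs a f \<epsilon>_thr D i E)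
       else threshold_loop a f \<epsilon>_thr k D is (charge \<epsilon>_thr (bin_docs a f \<epsilon>_thr D i E) E)
         (s + real (card (bin_docs a f \<epsilon>_thr D i E)) + \<xi>) (A \<union> bin_docs a f \<epsilon>_thr D i E))"
  by (simp only: threshold_loop.simps Let_def bin_docs_def)

declare threshold_loop.simps(2) [simp del]

lemma measurable_threshold_loop:
  assumes "\<epsilon>_thr > 0"
  shows "(\<lambda>s. threshold_loop a f \<epsilon>_thr k D is E s A) \<in> borel \<rightarrow>\<^sub>M prob_algebra (count_space UNIV)"
proof (induction "is" arbitrary: E A)
  case Nil
  then show ?case by (simp add: return_in_space_prob_algebra)
next
  case (Cons i "is")
  note [measurable] = Cons.IH
  have [measurable]: "(\<lambda>_. return (count_space UNIV) x) \<in> borel \<Otimes>\<^sub>M borel \<rightarrow>\<^sub>M prob_algebra (count_space UNIV)"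
    for x :: "('a doc \<Rightarrow> real) \<times> 'a doc set"
    by (intro measurable_const return_in_space_prob_algebra) simp
  show ?case
    unfolding threshold_loop_Cons
  proof (rule measurable_bind_prob_space2[where N = borel])
    show "(\<lambda>s. laplace (1 / \<epsilon>_thr)) \<in> borel \<rightarrow>\<^sub>M prob_algebra borel"
      using assms by (intro measurable_const laplace_in_space_prob_algebra) simp
  qed measurable
qed

lemma threshold_loop_in_space_prob_algebra:
  "\<epsilon>_thr > 0 \<Longrightarrow> threshold_loop a f \<epsilon>_thr k D is E s A \<in> space (prob_algebra (count_space UNIV))"
  using measurable_space[OF measurable_threshold_loop] by simp

text \<open>The integral of \<open>H\<close> over the rest of the loop as a function of the noisy
  count \<open>s\<close> after a bin. It turns one iteration into a single Laplace integral, to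
  which the shift bound applies.\<close>

definition threshold_step ::
    "(nat \<Rightarrow> real) \<Rightarrow> ('v doc \<Rightarrow> real) \<Rightarrow> real \<Rightarrow> nat \<Rightarrow> 'v doc set \<Rightarrow> nat list \<Rightarrow>
     (('v doc \<Rightarrow> real) \<times> 'v doc set \<Rightarrow> ennreal) \<Rightarrow> ('v doc \<Rightarrow> real) \<Rightarrow> 'v doc set \<Rightarrow> real \<Rightarrow> ennreal" where
  "threshold_step a f \<epsilon>_thr k D is H E A s =
     (if s \<ge> real k then H (E, A) else \<integral>\<^sup>+w. H w \<partial>threshold_loop a f \<epsilon>_thr k D is E s A)"

lemma measurable_threshold_step:
  assumes "\<epsilon>_thr > 0"
  shows "threshold_step a f \<epsilon>_thr k D is H E A \<in> borel_measurable borel"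
proof -
  have [measurable]: "(\<lambda>s. \<integral>\<^sup>+w. H w \<partial>threshold_loop a f \<epsilon>_thr k D is E s A) \<in> borel_measurable borel"
    by (rule measurable_nn_integral_prob_algebra[OF measurable_threshold_loop[OF assms]]) simp
  show ?thesis
    unfolding threshold_step_def by measurable
qed

lemma nn_integral_threshold_loop_Cons:
  assumes "\<epsilon>_thr > 0"
  shows "(\<integral>\<^sup>+w. H w \<partial>threshold_loop a f \<epsilon>_thr k D (i # is) E s A) =
    (\<integral>\<^sup>+\<xi>. threshold_step a f \<epsilon>_thr k D is H (charge \<epsilon>_thr (bin_docs a f \<epsilon>_thr D i E) E)
      (A \<union> bin_docs a f \<epsilon>_thr D i E) (s + real (card (bin_docs a f \<epsilon>_thr D i E)) + \<xi>) \<partial>laplace (1 / \<epsilon>_thr))"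
proof -
  let ?S = "bin_docs a f \<epsilon>_thr D i E"
  let ?E = "charge \<epsilon>_thr ?S E"
  have L: "laplace (1 / \<epsilon>_thr) \<in> space (prob_algebra borel)"
    using assms by (intro laplace_in_space_prob_algebra) simp
  note [measurable] = measurable_threshold_loop[OF assms]
  have [measurable]: "(\<lambda>_. return (count_space UNIV) (?E, A \<union> ?S)) \<in> borel \<rightarrow>\<^sub>M prob_algebra (count_space UNIV)"
    by (intro measurable_const return_in_space_prob_algebra) simp
  have K: "(\<lambda>\<xi>. if s + real (card ?S) + \<xi> \<ge> real k then return (count_space UNIV) (?E, A \<union> ?S)
      else threshold_loop a f \<epsilon>_thr k D is ?E (s + real (card ?S) + \<xi>) (A \<union> ?S))
      \<in> borel \<rightarrow>\<^sub>M prob_algebra (count_space UNIV)"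
    by measurable
  show ?thesis
    unfolding threshold_loop_Cons nn_integral_bind_prob_algebra[OF L K] threshold_step_def
    by (auto intro!: nn_integral_cong simp: nn_integral_return)
qed

text \<open>The invariant of two runs on \<open>D\<close> and \<open>insert z D\<close>. The budget \<open>E z\<close> of the first run is
  unconstrained because \<open>z\<close> is never read there; \<open>E' z\<close> is the privacy loss still to come.\<close>

definition coupled ::
    "'a \<Rightarrow> 'a set \<Rightarrow> ('a \<Rightarrow> real) \<Rightarrow> ('a \<Rightarrow> real) \<Rightarrow> 'a set \<Rightarrow> 'a set \<Rightarrow> bool" where
  "coupled z D E E' A A' \<longleftrightarrow>
     (\<forall>y. y \<noteq> z \<longrightarrow> E y = E' y) \<and> 0 \<le> E' z \<and> A \<subseteq> D \<and> (A' = A \<or> A' = insert z A)"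

text \<open>\<open>A \<subseteq> D\<close> keeps \<open>z\<close> out of the selection of the first
  run, and every other document has equal budgets in both runs.\<close>

lemma coupled_eligible:
  assumes "coupled z D E E' A A'" and "z \<notin> D" and "A' = A \<or> \<not> P (E' z)"
  shows "{y \<in> A'. P (E' y)} = {y \<in> A. P (E y)}"
  using assms unfolding coupled_def by auto

lemma coupled_eligible_insert:
  assumes "coupled z D E E' A (insert z A)" and "z \<notin> D" and "P (E' z)"
  shows "{y \<in> insert z A. P (E' y)} = insert z {y \<in> A. P (E y)}"
  using assms unfolding coupled_def by auto

lemma coupled_charge:
  assumes "coupled z D E E' A A'" and "S \<subseteq> D" and "z \<notin> D"
  shows "coupled z D (charge \<delta> S E) (charge \<delta> S E') (A \<union> S) (A' \<union> S)" "charge \<delta> S E' z = E' z"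
  using assms unfolding coupled_def charge_def by auto

text \<open>Affordability \<open>\<delta> \<le> E' z\<close> keeps the remaining budget nonnegative.
  The drop by \<open>\<delta>\<close> pays for the influence of \<open>z\<close> on this
  step.\<close>

lemma coupled_charge_insert:
  assumes "coupled z D E E' A A'" and "S \<subseteq> D" and "z \<notin> D" and "\<delta> \<le> E' z"
  shows "coupled z D (charge \<delta> S E) (charge \<delta> (insert z S) E') (A \<union> S) (A' \<union> insert z S)"
    "charge \<delta> (insert z S) E' z = E' z - \<delta>"
  using assms unfolding coupled_def charge_def by auto

text \<open>\<open>H\<close> and \<open>H'\<close> stand for the integrals over everything after the
  loop. Each bin that counts \<open>z\<close> costs \<open>\<epsilon>_thr\<close> and lowers
  \<open>E' z\<close> by the same amount, so induction on the bins bounds the total by the initial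
  \<open>E' z\<close>.\<close>

lemma close_threshold_loop:
  assumes thr: "\<epsilon>_thr > 0" and D: "finite D" "z \<notin> D"
    and H: "\<And>E E' A A'. coupled z D E E' A A' \<Longrightarrow> close (E' z) (H (E, A)) (H' (E', A'))"
    and "coupled z D E E' A A'"
  shows "close (E' z) (\<integral>\<^sup>+w. H w \<partial>threshold_loop a f \<epsilon>_thr k D is E s A)
    (\<integral>\<^sup>+w. H' w \<partial>threshold_loop a f \<epsilon>_thr k (insert z D) is E' s A')"
  using assms(5)
proof (induction "is" arbitrary: E E' s A A')
  case Nil
  then show ?case using H by (simp add: nn_integral_return)
next
  case (Cons i "is")
  have step: "close (E' z) (threshold_step a f \<epsilon>_thr k D is H E A s)
      (threshold_step a f \<epsilon>_thr k (insert z D) is H' E' A' s)"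
    if "coupled z D E E' A A'" for E E' A A' s
    using that H Cons.IH by (simp add: threshold_step_def)
  have E: "\<And>y. y \<in> D \<Longrightarrow> E y = E' y"
    using Cons.prems D(2) unfolding coupled_def by metis
  define S where "S = bin_docs a f \<epsilon>_thr D i E"
  define S' where "S' = bin_docs a f \<epsilon>_thr (insert z D) i E'"
  have S: "S \<subseteq> D"
    by (auto simp: S_def bin_docs_def)
  note [measurable] = measurable_threshold_step[OF thr]
  show ?case
  proof (cases "f z \<in> {a i..<a (Suc i)} \<and> E' z \<ge> \<epsilon>_thr")
    case True
    have S': "S' = insert z S"
      unfolding S_def S'_def bin_docs_def using True E by auto
    have card: "real (card S') = real (card S) + 1"
      unfolding S' using S D finite_subset by (subst card_insert_disjoint) auto
    have "coupled z D (charge \<epsilon>_thr S E) (charge \<epsilon>_thr S' E') (A \<union> S) (A' \<union> S')"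
      "charge \<epsilon>_thr S' E' z = E' z - \<epsilon>_thr"
      unfolding S' using coupled_charge_insert[OF Cons.prems S D(2)] True by auto
    note c = step[OF this(1), unfolded this(2)]
    \<comment> \<open>The count of the second run is larger by one. Lowering its noise by one, at
      cost \<open>\<epsilon>_thr\<close>, makes the noisy counts equal, so both runs leave the loop
      or continue together.\<close>
    have "close (E' z - \<epsilon>_thr + \<bar>-1\<bar> / (1 / \<epsilon>_thr))
      (\<integral>\<^sup>+\<xi>. threshold_step a f \<epsilon>_thr k D is H (charge \<epsilon>_thr S E) (A \<union> S) (s + real (card S) + \<xi>) \<partial>laplace (1 / \<epsilon>_thr))
      (\<integral>\<^sup>+\<xi>. threshold_step a f \<epsilon>_thr k (insert z D) is H' (charge \<epsilon>_thr S' E') (A' \<union> S') (s + real (card S') + \<xi>) \<partial>laplace (1 / \<epsilon>_thr))"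
    proof (rule close_nn_integral_laplace)
      fix \<xi>
      have "s + real (card S') + (\<xi> + - 1) = s + real (card S) + \<xi>"
        by (simp add: card)
      then show "close (E' z - \<epsilon>_thr)
        (threshold_step a f \<epsilon>_thr k D is H (charge \<epsilon>_thr S E) (A \<union> S) (s + real (card S) + \<xi>))
        (threshold_step a f \<epsilon>_thr k (insert z D) is H' (charge \<epsilon>_thr S' E') (A' \<union> S') (s + real (card S') + (\<xi> + - 1)))"
        by (simp only: c)
    qed (use thr in \<open>simp, measurable\<close>)
    then show ?thesis
      unfolding nn_integral_threshold_loop_Cons[OF thr] S_def[symmetric] S'_def[symmetric] by simp
  next
    case False
    have S': "S' = S"
      unfolding S_def S'_def bin_docs_def using False E by auto
    note c = coupled_charge[OF Cons.prems S D(2), of \<epsilon>_thr]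
    show ?thesis
      unfolding nn_integral_threshold_loop_Cons[OF thr] S_def[symmetric] S'_def[symmetric] S'
    proof (rule close_nn_integral)
      fix \<xi>
      show "close (E' z)
        (threshold_step a f \<epsilon>_thr k D is H (charge \<epsilon>_thr S E) (A \<union> S) (s + real (card S) + \<xi>))
        (threshold_step a f \<epsilon>_thr k (insert z D) is H' (charge \<epsilon>_thr S E') (A' \<union> S) (s + real (card S) + \<xi>))"
        using step[OF c(1)] c(2) by simp
    qed measurable
  qed
qed

section \<open>The loop over the queries\<close>

definition murag_answer ::
    "'v::finite dprag_params \<Rightarrow> 'v score \<Rightarrow> 'v llm \<Rightarrow> real \<Rightarrow> nat \<Rightarrow> 'v list \<Rightarrow> 'v doc set \<Rightarrow> 'v list measure" where
  "murag_answer P r LLM \<epsilon>_RAG k q A = dprag P r q (mset (topk (mset_set (Some ` A)) k (\<lambda>z. r z q))) LLM \<epsilon>_RAG"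

lemma murag_answer_in_space_prob_algebra:
  "token_budget P > 0 \<Longrightarrow> murag_answer P r LLM \<epsilon>_RAG k q A \<in> space (prob_algebra (count_space UNIV))"
  unfolding murag_answer_def by (rule dprag_in_space_prob_algebra)

text \<open>Adding \<open>z\<close> either leaves the finally retrieved list unchanged or exchanges
  one of its entries.\<close>

lemma close_murag_answer:
  assumes P: "token_budget P > 0" and "\<epsilon>_RAG \<ge> 0" and A: "finite A" "z \<notin> A"
    and inj: "inj_on (\<lambda>z. r z q) (insert z A)"
  shows "close \<epsilon>_RAG (\<integral>\<^sup>+y. g y \<partial>murag_answer P r LLM \<epsilon>_RAG k q A)
    (\<integral>\<^sup>+y. g y \<partial>murag_answer P r LLM \<epsilon>_RAG k q (insert z A))"
proof -
  let ?f = "\<lambda>z. r z q" and ?K = "voters P * docs_per_voter P"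
  let ?X = "mset_set (Some ` A)"
  have ins: "mset_set (Some ` insert z A) = add_mset (Some z) ?X"
    using A by (simp add: image_iff)
  \<comment> \<open>Without ties real documents have distinct finite ranks, and padding has rank
    \<open>-\<infinity>\<close>.\<close>
  have "inj_on (rank ?f) (insert None (set_mset (add_mset (Some z) ?X)))"
    using inj A by (auto simp: inj_on_def)
  from topk_topk_add_mset[OF this, of k ?K] show ?thesis
  proof
    assume eq: "topk (mset (topk ?X k ?f)) ?K ?f = topk (mset (topk (add_mset (Some z) ?X) k ?f)) ?K ?f"
    \<comment> \<open>The single-query algorithm reads its entries only through the retrieved
      list.\<close>
    have "murag_answer P r LLM \<epsilon>_RAG k q A = murag_answer P r LLM \<epsilon>_RAG k q (insert z A)"
      unfolding murag_answer_def ins dprag_def Let_def eq ..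
    then show ?thesis
      using \<open>\<epsilon>_RAG \<ge> 0\<close> by (simp add: close_refl)
  qed (use assms close_dprag ins in \<open>auto simp: murag_answer_def\<close>)
qed

lemma murag_ada_loop_Cons:
  "murag_ada_loop P r LLM B a \<epsilon>_thr \<epsilon>_RAG k D (q # qs) E =
    threshold_loop a (\<lambda>z. r z q) \<epsilon>_thr k D [1..<Suc B] E 0 {} \<bind> (\<lambda>w.
      murag_answer P r LLM \<epsilon>_RAG k q {z \<in> snd w. \<epsilon>_RAG \<le> fst w z} \<bind> (\<lambda>ans.
        murag_ada_loop P r LLM B a \<epsilon>_thr \<epsilon>_RAG k D qs (charge \<epsilon>_RAG {z \<in> snd w. \<epsilon>_RAG \<le> fst w z} (fst w)) \<bind>
          (\<lambda>rest. return (count_space UNIV) (ans # rest))))"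
  by (simp only: murag_ada_loop.simps Let_def case_prod_unfold murag_answer_def)

declare murag_ada_loop.simps(2) [simp del]

lemma murag_ada_loop_in_space_prob_algebra:
  assumes "token_budget P > 0" and "\<epsilon>_thr > 0"
  shows "murag_ada_loop P r LLM B a \<epsilon>_thr \<epsilon>_RAG k D qs E \<in> space (prob_algebra (count_space UNIV))"
proof (induction qs arbitrary: E)
  case Nil
  then show ?case by (simp add: return_in_space_prob_algebra)
next
  case (Cons q qs)
  then show ?case
    unfolding murag_ada_loop_Cons using assms
    by (auto simp only: measurable_count_space_eq1 space_count_space UNIV_I intro!: return_in_space_prob_algebra
      bind_in_space_prob_algebra[OF threshold_loop_in_space_prob_algebra]
      bind_in_space_prob_algebra[OF murag_answer_in_space_prob_algebra]
      bind_in_space_prob_algebra[OF Cons.IH])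
qed

lemma nn_integral_murag_ada_loop_Cons:
  assumes "token_budget P > 0" and "\<epsilon>_thr > 0"
  shows "(\<integral>\<^sup>+y. g y \<partial>murag_ada_loop P r LLM B a \<epsilon>_thr \<epsilon>_RAG k D (q # qs) E) =
    (\<integral>\<^sup>+w. \<integral>\<^sup>+ans. \<integral>\<^sup>+rest. g (ans # rest)
      \<partial>murag_ada_loop P r LLM B a \<epsilon>_thr \<epsilon>_RAG k D qs (charge \<epsilon>_RAG {z \<in> snd w. \<epsilon>_RAG \<le> fst w z} (fst w))
      \<partial>murag_answer P r LLM \<epsilon>_RAG k q {z \<in> snd w. \<epsilon>_RAG \<le> fst w z}
      \<partial>threshold_loop a (\<lambda>z. r z q) \<epsilon>_thr k D [1..<Suc B] E 0 {})"
proof -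
  note T = threshold_loop_in_space_prob_algebra[OF assms(2)]
  note R = murag_answer_in_space_prob_algebra[OF assms(1)]
  note L = murag_ada_loop_in_space_prob_algebra[OF assms]
  have K1: "(\<lambda>rest. return (count_space UNIV) (ans # rest)) \<in> count_space UNIV \<rightarrow>\<^sub>M prob_algebra (count_space UNIV)"
    for ans :: "'a list"
    by (simp add: return_in_space_prob_algebra)
  have K2: "(\<lambda>ans. murag_ada_loop P r LLM B a \<epsilon>_thr \<epsilon>_RAG k D qs E \<bind>
      (\<lambda>rest. return (count_space UNIV) (ans # rest))) \<in> count_space UNIV \<rightarrow>\<^sub>M prob_algebra (count_space UNIV)" for E
    using bind_in_space_prob_algebra[OF L K1] by simp
  have K3: "(\<lambda>w. murag_answer P r LLM \<epsilon>_RAG k q {z \<in> snd w. \<epsilon>_RAG \<le> fst w z} \<bind> (\<lambda>ans.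
        murag_ada_loop P r LLM B a \<epsilon>_thr \<epsilon>_RAG k D qs (charge \<epsilon>_RAG {z \<in> snd w. \<epsilon>_RAG \<le> fst w z} (fst w)) \<bind>
          (\<lambda>rest. return (count_space UNIV) (ans # rest)))) \<in> count_space UNIV \<rightarrow>\<^sub>M prob_algebra (count_space UNIV)"
    using bind_in_space_prob_algebra[OF R K2] by simp
  show ?thesis
    unfolding murag_ada_loop_Cons nn_integral_bind_prob_algebra[OF T K3]
      nn_integral_bind_prob_algebra[OF R K2] nn_integral_bind_prob_algebra[OF L K1]
    by (simp add: nn_integral_return)
qed

text \<open>Induction on the queries, with the integral over the answer and all later answers as
  integrand for the threshold loop. The function \<open>g\<close> is arbitrary because the later
  answers are integrated against \<open>g (ans # rest)\<close>.\<close>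

lemma close_murag_ada_loop:
  assumes P: "token_budget P > 0" and thr: "\<epsilon>_thr > 0" and RAG: "\<epsilon>_RAG \<ge> 0" and D: "finite D" "z \<notin> D"
    and "\<forall>q\<in>set qs. inj_on (\<lambda>z. r z q) (insert z D)"
    and "\<And>y. y \<noteq> z \<Longrightarrow> E y = E' y" and "0 \<le> E' z"
  shows "close (E' z) (\<integral>\<^sup>+y. g y \<partial>murag_ada_loop P r LLM B a \<epsilon>_thr \<epsilon>_RAG k D qs E)
    (\<integral>\<^sup>+y. g y \<partial>murag_ada_loop P r LLM B a \<epsilon>_thr \<epsilon>_RAG k (insert z D) qs E')"
  using assms(6-8)
proof (induction qs arbitrary: E E' g)
  case Nil
  then show ?case by (simp add: nn_integral_return close_refl)
next
  case (Cons q qs)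
  have meas: "f \<in> borel_measurable (murag_answer P r LLM \<epsilon>_RAG k q A)" for f :: "'a list \<Rightarrow> ennreal" and A
  proof -
    have eq: "sets (murag_answer P r LLM \<epsilon>_RAG k q A) = sets (count_space UNIV)"
      using murag_answer_in_space_prob_algebra[OF P, of r LLM \<epsilon>_RAG k q A]
      unfolding space_prob_algebra by blast
    show ?thesis
      unfolding measurable_cong_sets[OF eq refl] by simp
  qed
  show ?case
    unfolding nn_integral_murag_ada_loop_Cons[OF P thr]
  proof (rule close_threshold_loop[OF thr D])
    show "coupled z D E E' {} {}"
      using Cons.prems by (simp add: coupled_def)
  next
    fix E E' A A'
    assume c: "coupled z D E E' A A'"
    define S where "S = {y \<in> A. \<epsilon>_RAG \<le> E y}"
    define S' where "S' = {y \<in> A'. \<epsilon>_RAG \<le> E' y}"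
    let ?V = "\<lambda>E ans. \<integral>\<^sup>+rest. g (ans # rest) \<partial>murag_ada_loop P r LLM B a \<epsilon>_thr \<epsilon>_RAG k D qs E"
    let ?V' = "\<lambda>E ans. \<integral>\<^sup>+rest. g (ans # rest) \<partial>murag_ada_loop P r LLM B a \<epsilon>_thr \<epsilon>_RAG k (insert z D) qs E"
    have rest: "close (E' z) (?V E ans) (?V' E' ans)" if "coupled z D E E' A A'" for E E' A A' ans
      using that Cons.prems(1) by (intro Cons.IH) (auto simp: coupled_def)
    have S: "S \<subseteq> D"
      using c by (auto simp: S_def coupled_def)
    have "close (E' z) (\<integral>\<^sup>+ans. ?V (charge \<epsilon>_RAG S E) ans \<partial>murag_answer P r LLM \<epsilon>_RAG k q S)
        (\<integral>\<^sup>+ans. ?V' (charge \<epsilon>_RAG S' E') ans \<partial>murag_answer P r LLM \<epsilon>_RAG k q S')"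
    \<comment> \<open>If \<open>z\<close> was not selected or cannot pay, both runs answer from the
      same set and \<open>z\<close> is not charged.\<close>
    proof (cases "A' = A \<or> \<not> \<epsilon>_RAG \<le> E' z")
      case True
      have S': "S' = S"
        using coupled_eligible[OF c D(2), of "\<lambda>e. \<epsilon>_RAG \<le> e"] True by (simp add: S_def S'_def)
      show ?thesis
        unfolding S' using rest[OF coupled_charge(1)[OF c S D(2)]] coupled_charge(2)[OF c S D(2)]
        by (intro close_nn_integral meas) simp
    next
      case False
      then have "A' = insert z A" "\<epsilon>_RAG \<le> E' z"
        using c by (auto simp: coupled_def)
      then have S': "S' = insert z S"
        using coupled_eligible_insert[of z D E E' A "\<lambda>e. \<epsilon>_RAG \<le> e"] c D(2) by (simp add: S_def S'_def)
      have cl: "close (E' z - \<epsilon>_RAG) (?V (charge \<epsilon>_RAG S E) ans) (?V' (charge \<epsilon>_RAG S' E') ans)" for ans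
        unfolding S'
        using rest[OF coupled_charge_insert(1)[OF c S D(2)]] coupled_charge_insert(2)[OF c S D(2)] \<open>\<epsilon>_RAG \<le> E' z\<close>
        by simp
      have "inj_on (\<lambda>z. r z q) (insert z S)"
        using Cons.prems(1) S by (auto intro: inj_on_subset)
      moreover have "finite S" "z \<notin> S"
        using S D finite_subset by auto
      \<comment> \<open>First the later answers are exchanged under a common law of the current
        answer, at cost \<open>E' z - \<epsilon>_RAG\<close>; then the law of the current answer is
        exchanged, at cost \<open>\<epsilon>_RAG\<close>.\<close>
      ultimately have "close (E' z - \<epsilon>_RAG + \<epsilon>_RAG)
        (\<integral>\<^sup>+ans. ?V (charge \<epsilon>_RAG S E) ans \<partial>murag_answer P r LLM \<epsilon>_RAG k q S)
        (\<integral>\<^sup>+ans. ?V' (charge \<epsilon>_RAG S' E') ans \<partial>murag_answer P r LLM \<epsilon>_RAG k q (insert z S))"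
        by (intro close_trans[OF close_nn_integral[OF cl meas meas] close_murag_answer] P RAG)
      then show ?thesis
        by (simp add: S')
    qed
    then show "close (E' z)
      (\<integral>\<^sup>+ans. ?V (charge \<epsilon>_RAG {z \<in> snd (E, A). \<epsilon>_RAG \<le> fst (E, A) z} (fst (E, A))) ans
        \<partial>murag_answer P r LLM \<epsilon>_RAG k q {z \<in> snd (E, A). \<epsilon>_RAG \<le> fst (E, A) z})
      (\<integral>\<^sup>+ans. ?V' (charge \<epsilon>_RAG {z \<in> snd (E', A'). \<epsilon>_RAG \<le> fst (E', A') z} (fst (E', A'))) ans
        \<partial>murag_answer P r LLM \<epsilon>_RAG k q {z \<in> snd (E', A'). \<epsilon>_RAG \<le> fst (E', A') z})"
      by (simp add: S_def S'_def)
  qed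
qed

text \<open>Integrals of indicators are probabilities; these are finite, so the bound passes from
  \<open>ennreal\<close> to the reals.\<close>

lemma measure_le_of_close:
  assumes "M \<in> space (prob_algebra (count_space UNIV))" and "M' \<in> space (prob_algebra (count_space UNIV))"
    and "close \<epsilon> (\<integral>\<^sup>+y. indicator S y \<partial>M) (\<integral>\<^sup>+y. indicator S y \<partial>M')"
  shows "measure M S \<le> exp \<epsilon> * measure M' S"
proof -
  interpret M: prob_space M
    using assms(1) by (simp add: space_prob_algebra)
  interpret M': prob_space M'
    using assms(2) by (simp add: space_prob_algebra)
  have "sets M = UNIV" "sets M' = UNIV"
    using assms(1,2) by (auto simp: space_prob_algebra)
  then have "ennreal (measure M S) \<le> ennreal (exp \<epsilon> * measure M' S)"
    using assms(3) by (simp add: close_def M.emeasure_eq_measure M'.emeasure_eq_measure ennreal_mult)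
  then show ?thesis
    by (simp add: ennreal_le_iff)
qed

theorem theorem2:
  fixes P :: "'v::finite dprag_params"
    and r :: "'v score"
    and LLM :: "'v llm"
    and T k M B :: nat
    and a :: "nat \<Rightarrow> real"
    and \<epsilon> \<epsilon>_q \<epsilon>_thr \<epsilon>_RAG :: real
    and qs :: "'v list list"
  assumes "T \<ge> 1" and "k \<ge> 1" and "M \<ge> 1" and "B \<ge> 1"
    and "token_budget P > 0"
    and "disjoint_family_on (\<lambda>i. {a i..<a (Suc i)}) {1..B}"
    and "\<epsilon>_thr > 0" and "\<epsilon>_RAG > 0" and "\<epsilon>_q = \<epsilon>_thr + \<epsilon>_RAG"
    and "length qs = T"
    and "\<epsilon> > 0" and "real M * \<epsilon>_q \<le> \<epsilon>"
  shows "differentially_private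
           {D. finite D \<and> (\<forall>q\<in>set qs. inj_on (\<lambda>z. r z q) D)} (count_space UNIV) \<epsilon>
           (murag_ada P r LLM B a \<epsilon>_thr \<epsilon>_RAG k M qs)"
proof -
  let ?A = "murag_ada P r LLM B a \<epsilon>_thr \<epsilon>_RAG k M qs"
  have space: "?A D \<in> space (prob_algebra (count_space UNIV))" for D
    unfolding murag_ada_def using assms by (intro murag_ada_loop_in_space_prob_algebra)
  \<comment> \<open>Closeness is symmetric, so the addition of a document covers the removal as
    well.\<close>
  have close: "close \<epsilon> (\<integral>\<^sup>+y. g y \<partial>?A D) (\<integral>\<^sup>+y. g y \<partial>?A (insert z D))"
    if "finite D" "z \<notin> D" "\<forall>q\<in>set qs. inj_on (\<lambda>z. r z q) (insert z D)" for D z g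
  proof (rule close_mono)
    \<comment> \<open>Both runs start from the same constant budgets, and the initial budget of
      \<open>z\<close> bounds its whole privacy loss.\<close>
    show "close (real M * (\<epsilon>_thr + \<epsilon>_RAG)) (\<integral>\<^sup>+y. g y \<partial>?A D) (\<integral>\<^sup>+y. g y \<partial>?A (insert z D))"
      unfolding murag_ada_def
      by (rule close_murag_ada_loop[where E' = "\<lambda>_. real M * (\<epsilon>_thr + \<epsilon>_RAG)"]) (use assms that in auto)
    show "real M * (\<epsilon>_thr + \<epsilon>_RAG) \<le> \<epsilon>"
      using assms by simp
  qed
  show ?thesis
    unfolding differentially_private_def neighboring_def
    using space by (auto intro!: measure_le_of_close close close_sym[OF close])
qed

end
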